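(* Let $\nu,\lambda>0$, $\rho\in H^{-1}(\mathbb T^d)$, and let $f:L^2(\mathbb T^d)\to L^2(\mathbb T^d)$ be continuous and $\alpha$ monotone for some $\alpha>0$. Let $0<\delta<2\alpha$. Let $L=-\nu\Delta+\lambda\,\mathrm{Id}$ and $\tilde K=\{g\in L^2(\mathbb T^d): L^{-1}g\le 0\}$. For any $u_0\in H^2(\mathbb T^d)$ with $u_0\le 0$, let $(u_n,m_n)_{n\ge0}$ be defined by: $m_n\in L^2(\mathbb T^d)$, $m_n\ge 0$, is such that $$\int_{\mathbb T^d}(f(m_n)+\nu\Delta u_n-\lambda u_n)(\mu-m_n)\ge 0\quad\forall\mu\in L^2(\mathbb T^d),\ \mu\ge0,$$ and $u_{n+1}\in H^2(\mathbb T^d)$ is defined by $$Lu_{n+1}=\mathbf P_{\tilde K}\big(Lu_n-\delta(m_n-L^{-1}\rho)\big).$$ Then $(m_n)_{n\ge0}$ converges to $m$ in $L^2(\mathbb T^d)$, where $(u,m)\in H^2(\mathbb T^d)\times H^1(\mathbb T^d)$ is the only solution of the system $$\begin{cases}\forall v\in H^1(\mathbb T^d),\ v\le 0:\\ (f(m)+\nu\Delta u-\lambda u,\,v-u)_{H^{-1}\times H^1}\le 0;\\ (-\nu\Delta m+\lambda m-\rho,\,v-u)_{H^{-1}\times H^1}\ge 0;\\ \int_{\mathbb T^d}(f(m)+\nu\Delta u-\lambda u)\,m=0;\\ u\le 0;\quad m\ge 0.\end{cases}$$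
   Context: $\mathbb T^d$ is the $d$-dimensional torus. A map $f:L^2(\mathbb T^d)\to L^2(\mathbb T^d)$ is $\alpha$ monotone if $\int_{\mathbb T^d}(f(m)-f(m'))(m-m')\ge\alpha\|m-m'\|_{L^2}^2$ for all $m,m'\in L^2(\mathbb T^d)$. $\mathbf P_A$ denotes the orthogonal projection in $L^2(\mathbb T^d)$ onto the closed convex set $A$. Inequalities between functions are a.e. Here $\rho$ is the entry rate of players (a mean field game of optimal stopping with zero exit cost). Existence and uniqueness of the solution $(u,m)\in H^2(\mathbb T^d)\times H^1(\mathbb T^d)$ of the system is taken as known (it is a recalled result for strictly monotone $f$). *)

theory Defs
  imports "HOL-Analysis.Analysis"
begin

section \<open>The space \<open>L\<^sup>2\<close> of the torus\<close>

text \<open>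
  The torus is \<open>\<real>\<^sup>d / \<int>\<^sup>d\<close> with \<open>d = CARD('d)\<close>, represented by the unit cube; the faces of the
  cube are null sets.  Periodicity enters only through the test functions in the definition of
  weak derivatives.
\<close>

definition torus :: "(real ^ 'd::finite) measure" where
  "torus = restrict_space lborel (cbox 0 1)"

definition square_integrable :: "(real ^ 'd::finite \<Rightarrow> real) \<Rightarrow> bool" where
  "square_integrable f \<longleftrightarrow> f \<in> borel_measurable torus \<and> integrable torus (\<lambda>x. (f x)\<^sup>2)"

lemma square_integrable_0: "square_integrable (\<lambda>x. 0)"
  by (simp add: square_integrable_def)

lemma square_integrable_mult:
  assumes "square_integrable f" "square_integrable g"
  shows "integrable torus (\<lambda>x. f x * g x)"
proof (rule Bochner_Integration.integrable_bound)
  show "integrable torus (\<lambda>x. (f x)\<^sup>2 + (g x)\<^sup>2)"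
    using assms by (auto simp: square_integrable_def)
  show "(\<lambda>x. f x * g x) \<in> borel_measurable torus"
    using assms by (auto simp: square_integrable_def)
  have "\<bar>a * b\<bar> \<le> a\<^sup>2 + b\<^sup>2" for a b :: real
  proof -
    have "2 * (\<bar>a\<bar> * \<bar>b\<bar>) \<le> a\<^sup>2 + b\<^sup>2"
      using sum_squares_bound[of "\<bar>a\<bar>" "\<bar>b\<bar>"] by (simp add: mult.assoc)
    moreover have "0 \<le> \<bar>a\<bar> * \<bar>b\<bar>"
      by simp
    ultimately show ?thesis
      unfolding abs_mult by linarith
  qed
  then show "AE x in torus. norm (f x * g x) \<le> norm ((f x)\<^sup>2 + (g x)\<^sup>2)"
    by simp
qed

lemma square_integrable_add:
  assumes "square_integrable f" "square_integrable g"
  shows "square_integrable (\<lambda>x. f x + g x)"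
  using assms square_integrable_mult[OF assms]
  by (auto simp: square_integrable_def power2_sum mult.assoc)

lemma square_integrable_scale:
  "square_integrable f \<Longrightarrow> square_integrable (\<lambda>x. c * f x)"
  by (auto simp: square_integrable_def power_mult_distrib)

quotient_type 'd torus_L2 = "real ^ 'd::finite \<Rightarrow> real" /
  partial: "\<lambda>f g. square_integrable f \<and> square_integrable g \<and> (AE x in torus. f x = g x)"
proof (rule part_equivpI)
  show "\<exists>f :: real ^ 'd \<Rightarrow> real. square_integrable f \<and> square_integrable f \<and> (AE x in torus. f x = f x)"
    using square_integrable_0 by auto
  show "symp (\<lambda>f g :: real ^ 'd \<Rightarrow> real.
      square_integrable f \<and> square_integrable g \<and> (AE x in torus. f x = g x))"
    by (rule sympI) (auto simp: eq_commute)
  show "transp (\<lambda>f g :: real ^ 'd \<Rightarrow> real.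
      square_integrable f \<and> square_integrable g \<and> (AE x in torus. f x = g x))"
    by (rule transpI) auto
qed

instantiation torus_L2 :: (finite) real_vector
begin

lift_definition zero_torus_L2 :: "'a torus_L2" is "\<lambda>x. 0"
  by (simp add: square_integrable_0)

lift_definition plus_torus_L2 :: "'a torus_L2 \<Rightarrow> 'a torus_L2 \<Rightarrow> 'a torus_L2"
  is "\<lambda>f g x. f x + g x"
  by (auto simp: square_integrable_add)

lift_definition scaleR_torus_L2 :: "real \<Rightarrow> 'a torus_L2 \<Rightarrow> 'a torus_L2"
  is "\<lambda>c f x. c * f x"
  by (auto simp: square_integrable_scale)

definition uminus_torus_L2 :: "'a torus_L2 \<Rightarrow> 'a torus_L2" where
  "- f = (-1) *\<^sub>R (f :: 'a torus_L2)"

definition minus_torus_L2 :: "'a torus_L2 \<Rightarrow> 'a torus_L2 \<Rightarrow> 'a torus_L2" where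
  "f - g = f + - (g :: 'a torus_L2)"

instance
proof
  fix a b :: real and f g h :: "'a torus_L2"
  show "f + g + h = f + (g + h)"
    by transfer (auto simp: square_integrable_add add.assoc)
  show "f + g = g + f"
    by transfer (auto simp: square_integrable_add add.commute)
  show "0 + f = f"
    by transfer auto
  show "- f + f = 0"
    unfolding uminus_torus_L2_def
    by transfer (auto simp: square_integrable_0)
  show "f - g = f + - g"
    by (rule minus_torus_L2_def)
  show "a *\<^sub>R (f + g) = a *\<^sub>R f + a *\<^sub>R g"
    by transfer (auto simp: square_integrable_add square_integrable_scale distrib_left)
  show "(a + b) *\<^sub>R f = a *\<^sub>R f + b *\<^sub>R f"
    by transfer (auto simp: square_integrable_add square_integrable_scale distrib_right)
  show "a *\<^sub>R b *\<^sub>R f = (a * b) *\<^sub>R f"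
    by transfer (auto simp: square_integrable_scale mult.assoc)
  show "1 *\<^sub>R f = f"
    by transfer auto
qed

end

instantiation torus_L2 :: (finite) real_inner
begin

lift_definition inner_torus_L2 :: "'a torus_L2 \<Rightarrow> 'a torus_L2 \<Rightarrow> real"
  is "\<lambda>f g. \<integral>x. f x * g x \<partial>torus"
proof -
  fix f f' g g' :: "real ^ 'a \<Rightarrow> real"
  assume f: "square_integrable f \<and> square_integrable f' \<and> (AE x in torus. f x = f' x)"
    and g: "square_integrable g \<and> square_integrable g' \<and> (AE x in torus. g x = g' x)"
  have "AE x in torus. f x * g x = f' x * g' x"
    using f g by auto
  moreover have "(\<lambda>x. f x * g x) \<in> borel_measurable torus" "(\<lambda>x. f' x * g' x) \<in> borel_measurable torus"
    using f g by (auto simp: square_integrable_def)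
  ultimately show "(\<integral>x. f x * g x \<partial>torus) = (\<integral>x. f' x * g' x \<partial>torus)"
    by (intro integral_cong_AE)
qed

definition norm_torus_L2 :: "'a torus_L2 \<Rightarrow> real" where
  "norm f = sqrt (inner f (f :: 'a torus_L2))"

definition sgn_torus_L2 :: "'a torus_L2 \<Rightarrow> 'a torus_L2" where
  "sgn f = f /\<^sub>R norm (f :: 'a torus_L2)"

definition dist_torus_L2 :: "'a torus_L2 \<Rightarrow> 'a torus_L2 \<Rightarrow> real" where
  "dist f g = norm (f - g :: 'a torus_L2)"

definition uniformity_torus_L2 :: "('a torus_L2 \<times> 'a torus_L2) filter" where
  "uniformity_torus_L2 = (INF e\<in>{0<..}. principal {(f, g). dist f (g :: 'a torus_L2) < e})"

definition open_torus_L2 :: "'a torus_L2 set \<Rightarrow> bool" where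
  "open_torus_L2 U \<longleftrightarrow>
     (\<forall>x\<in>U. eventually (\<lambda>(x', y). x' = x \<longrightarrow> y \<in> U) (uniformity :: ('a torus_L2 \<times> 'a torus_L2) filter))"

instance
proof
  fix a :: real and f g h :: "'a torus_L2"
  show "dist f g = norm (f - g)"
    by (rule dist_torus_L2_def)
  show "sgn f = f /\<^sub>R norm f"
    by (rule sgn_torus_L2_def)
  show "uniformity = (INF e\<in>{0<..}. principal {(x :: 'a torus_L2, y). dist x y < e})"
    by (rule uniformity_torus_L2_def)
  show "open U \<longleftrightarrow> (\<forall>x\<in>U. \<forall>\<^sub>F (x', y) in uniformity. x' = x \<longrightarrow> y \<in> U)" for U :: "'a torus_L2 set"
    by (rule open_torus_L2_def)
  show "inner f g = inner g f"
    by transfer (simp add: mult.commute)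
  show "inner (f + g) h = inner f h + inner g h"
    by transfer (auto simp: distrib_right square_integrable_mult)
  show "inner (a *\<^sub>R f) g = a * inner f g"
    by transfer (simp add: mult.assoc)
  show "0 \<le> inner f f"
    by transfer simp
  show "inner f f = 0 \<longleftrightarrow> f = 0"
  proof transfer
    fix f :: "real ^ 'a \<Rightarrow> real"
    assume f: "square_integrable f \<and> square_integrable f \<and> (AE x in torus. f x = f x)"
    then have "(\<integral>x. f x * f x \<partial>torus) = 0 \<longleftrightarrow> (AE x in torus. f x * f x = 0)"
      by (intro integral_nonneg_eq_0_iff_AE square_integrable_mult) auto
    then show "(\<integral>x. f x * f x \<partial>torus) = 0 \<longleftrightarrow>
        square_integrable f \<and> square_integrable (\<lambda>x :: real ^ 'a. 0 :: real) \<and> (AE x in torus. f x = 0)"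
      using f square_integrable_0 by auto
  qed
  show "norm f = sqrt (inner f f)"
    by (rule norm_torus_L2_def)
qed

end

instantiation torus_L2 :: (finite) order
begin

lift_definition less_eq_torus_L2 :: "'a torus_L2 \<Rightarrow> 'a torus_L2 \<Rightarrow> bool"
  is "\<lambda>f g. AE x in torus. f x \<le> g x"
  by auto

definition less_torus_L2 :: "'a torus_L2 \<Rightarrow> 'a torus_L2 \<Rightarrow> bool" where
  "f < g \<longleftrightarrow> f \<le> g \<and> \<not> g \<le> (f :: 'a torus_L2)"

instance
proof
  fix f g h :: "'a torus_L2"
  show "f < g \<longleftrightarrow> f \<le> g \<and> \<not> g \<le> f"
    by (rule less_torus_L2_def)
  show "f \<le> f"
    by transfer simp
  show "f \<le> g \<Longrightarrow> g \<le> h \<Longrightarrow> f \<le> h"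
    by transfer auto
  show "f \<le> g \<Longrightarrow> g \<le> f \<Longrightarrow> f = g"
    by transfer auto
qed

end


section \<open>Weak derivatives and Sobolev spaces\<close>

definition C1_periodic :: "(real ^ 'd::finite \<Rightarrow> real) \<Rightarrow> (real ^ 'd \<Rightarrow> real ^ 'd) \<Rightarrow> bool" where
  "C1_periodic \<phi> G \<longleftrightarrow>
     (\<forall>x i. \<phi> (x + axis i 1) = \<phi> x) \<and> (\<forall>x. GDERIV \<phi> x :> G x) \<and> continuous_on UNIV G"

lemma C1_periodic_measurable:
  assumes "C1_periodic \<phi> G"
  shows "\<phi> \<in> borel_measurable torus" "(\<lambda>x. G x $ i) \<in> borel_measurable torus"
proof -
  have "continuous_on UNIV \<phi>"
    using assms unfolding C1_periodic_def gderiv_def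
    by (meson continuous_at_imp_continuous_on has_derivative_continuous)
  then have "\<phi> \<in> borel_measurable borel"
    by (rule borel_measurable_continuous_onI)
  then show "\<phi> \<in> borel_measurable torus"
    by (simp add: torus_def measurable_restrict_space1)
  have "continuous_on UNIV (\<lambda>x. G x $ i)"
    using assms by (auto simp: C1_periodic_def intro: continuous_intros)
  then have "(\<lambda>x. G x $ i) \<in> borel_measurable borel"
    by (rule borel_measurable_continuous_onI)
  then show "(\<lambda>x. G x $ i) \<in> borel_measurable torus"
    by (simp add: torus_def measurable_restrict_space1)
qed

lift_definition has_weak_partial :: "'d::finite \<Rightarrow> 'd torus_L2 \<Rightarrow> 'd torus_L2 \<Rightarrow> bool"
  is "\<lambda>i v g. \<forall>\<phi> G. C1_periodic \<phi> G \<longrightarrow>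
        (\<integral>x. v x * (G x $ i) \<partial>torus) = - (\<integral>x. g x * \<phi> x \<partial>torus)"
proof -
  fix i :: 'd and v v' g g' :: "real ^ 'd \<Rightarrow> real"
  assume v: "square_integrable v \<and> square_integrable v' \<and> (AE x in torus. v x = v' x)"
    and g: "square_integrable g \<and> square_integrable g' \<and> (AE x in torus. g x = g' x)"
  have "((\<integral>x. v x * (G x $ i) \<partial>torus) = - (\<integral>x. g x * \<phi> x \<partial>torus)) \<longleftrightarrow>
      ((\<integral>x. v' x * (G x $ i) \<partial>torus) = - (\<integral>x. g' x * \<phi> x \<partial>torus))"
    if \<phi>: "C1_periodic \<phi> G" for \<phi> G
  proof -
    have "(\<integral>x. v x * (G x $ i) \<partial>torus) = (\<integral>x. v' x * (G x $ i) \<partial>torus)"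
      using v C1_periodic_measurable(2)[OF \<phi>, of i]
      by (intro integral_cong_AE borel_measurable_times) (auto simp: square_integrable_def)
    moreover have "(\<integral>x. g x * \<phi> x \<partial>torus) = (\<integral>x. g' x * \<phi> x \<partial>torus)"
      using g C1_periodic_measurable(1)[OF \<phi>]
      by (intro integral_cong_AE borel_measurable_times) (auto simp: square_integrable_def)
    ultimately show ?thesis
      by simp
  qed
  then show "(\<forall>\<phi> G. C1_periodic \<phi> G \<longrightarrow>
        (\<integral>x. v x * (G x $ i) \<partial>torus) = - (\<integral>x. g x * \<phi> x \<partial>torus)) \<longleftrightarrow>
      (\<forall>\<phi> G. C1_periodic \<phi> G \<longrightarrow>
        (\<integral>x. v' x * (G x $ i) \<partial>torus) = - (\<integral>x. g' x * \<phi> x \<partial>torus))"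
    by blast
qed

text \<open>Weak derivatives are unique, so the description below denotes the derivative on \<open>H1\<close>.\<close>

definition weak_partial :: "'d::finite \<Rightarrow> 'd torus_L2 \<Rightarrow> 'd torus_L2" where
  "weak_partial i v = (THE g. has_weak_partial i v g)"

definition H1 :: "'d::finite torus_L2 set" where
  "H1 = {v. \<forall>i. \<exists>g. has_weak_partial i v g}"

definition H2 :: "'d::finite torus_L2 set" where
  "H2 = {v \<in> H1. \<forall>i. weak_partial i v \<in> H1}"

definition laplacian :: "'d::finite torus_L2 \<Rightarrow> 'd torus_L2" where
  "laplacian u = (\<Sum>i\<in>UNIV. weak_partial i (weak_partial i u))"

definition H1_norm :: "'d::finite torus_L2 \<Rightarrow> real" where
  "H1_norm v = sqrt ((norm v)\<^sup>2 + (\<Sum>i\<in>UNIV. (norm (weak_partial i v))\<^sup>2))"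

text \<open>
  \<open>H\<^sup>-\<^sup>1\<close> is the dual of \<open>H\<^sup>1\<close>: an element is a functional, of which only the values on \<open>H1\<close>
  matter, and the \<open>H\<^sup>-\<^sup>1 \<times> H\<^sup>1\<close> pairing is application.
\<close>

definition Hminus1 :: "('d::finite torus_L2 \<Rightarrow> real) set" where
  "Hminus1 = {\<rho>. (\<forall>v\<in>H1. \<forall>w\<in>H1. \<rho> (v + w) = \<rho> v + \<rho> w) \<and>
                 (\<forall>c. \<forall>v\<in>H1. \<rho> (c *\<^sub>R v) = c * \<rho> v) \<and>
                 (\<exists>C. \<forall>v\<in>H1. \<bar>\<rho> v\<bar> \<le> C * H1_norm v)}"

definition L2_to_Hminus1 :: "'d::finite torus_L2 \<Rightarrow> 'd torus_L2 \<Rightarrow> real" where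
  "L2_to_Hminus1 g = (\<lambda>v. inner g v)"

definition weak_laplacian :: "'d::finite torus_L2 \<Rightarrow> 'd torus_L2 \<Rightarrow> real" where
  "weak_laplacian u = (\<lambda>v. - (\<Sum>i\<in>UNIV. inner (weak_partial i u) (weak_partial i v)))"


section \<open>The operator \<open>L = -\<nu>\<Delta> + \<lambda> Id\<close> and its inverse\<close>

definition ellop :: "real \<Rightarrow> real \<Rightarrow> 'd::finite torus_L2 \<Rightarrow> 'd torus_L2" where
  "ellop \<nu> lam u = - (\<nu> *\<^sub>R laplacian u) + lam *\<^sub>R u"

definition weak_ellop :: "real \<Rightarrow> real \<Rightarrow> 'd::finite torus_L2 \<Rightarrow> 'd torus_L2 \<Rightarrow> real" where
  "weak_ellop \<nu> lam u = (\<lambda>v. - (\<nu> * weak_laplacian u v) + lam * L2_to_Hminus1 u v)"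

text \<open>
  For \<open>\<nu>, lam > 0\<close> the operator is an isomorphism from \<open>H\<^sup>1\<close> onto \<open>H\<^sup>-\<^sup>1\<close>, so the description
  below is proper for every \<open>\<rho>\<close> in \<^term>\<open>Hminus1\<close>.
\<close>

definition ellop_inv :: "real \<Rightarrow> real \<Rightarrow> ('d::finite torus_L2 \<Rightarrow> real) \<Rightarrow> 'd torus_L2" where
  "ellop_inv \<nu> lam \<rho> = (THE w. w \<in> H1 \<and> (\<forall>v\<in>H1. weak_ellop \<nu> lam w v = \<rho> v))"

definition K_tilde :: "real \<Rightarrow> real \<Rightarrow> 'd::finite torus_L2 set" where
  "K_tilde \<nu> lam = {g. ellop_inv \<nu> lam (L2_to_Hminus1 g) \<le> 0}"

text \<open>The constant \<^const>\<open>closest_point\<close> is restricted to Heine-Borel spaces.\<close>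

definition proj_on :: "'a::real_inner set \<Rightarrow> 'a \<Rightarrow> 'a" where
  "proj_on A x = (THE y. y \<in> A \<and> (\<forall>z\<in>A. dist x y \<le> dist x z))"


section \<open>The system\<close>

definition alpha_monotone :: "real \<Rightarrow> ('a::real_inner \<Rightarrow> 'a) \<Rightarrow> bool" where
  "alpha_monotone \<alpha> f \<longleftrightarrow> (\<forall>m m'. inner (f m - f m') (m - m') \<ge> \<alpha> * (norm (m - m'))\<^sup>2)"

definition mfg_solution ::
  "real \<Rightarrow> real \<Rightarrow> ('d::finite torus_L2 \<Rightarrow> real) \<Rightarrow> ('d torus_L2 \<Rightarrow> 'd torus_L2) \<Rightarrow>
    'd torus_L2 \<Rightarrow> 'd torus_L2 \<Rightarrow> bool" where
  "mfg_solution \<nu> lam \<rho> f u m \<longleftrightarrow>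
     u \<in> H2 \<and> m \<in> H1 \<and>
     (\<forall>v\<in>H1. v \<le> 0 \<longrightarrow>
        L2_to_Hminus1 (f m + \<nu> *\<^sub>R laplacian u - lam *\<^sub>R u) (v - u) \<le> 0 \<and>
        weak_ellop \<nu> lam m (v - u) - \<rho> (v - u) \<ge> 0) \<and>
     inner (f m + \<nu> *\<^sub>R laplacian u - lam *\<^sub>R u) m = 0 \<and>
     u \<le> 0 \<and> m \<ge> 0"

end

theory Submission
  imports Defs
begin

text \<open>
  Write \<open>g = L u\<close>, \<open>g\<^sub>n = L u\<^sub>n\<close> and \<open>w = L\<^sup>-\<^sup>1 \<rho>\<close>.  The system for \<open>(u, m)\<close> implies two
  variational inequalities in \<open>L\<^sup>2\<close>.  On the cone of nonnegative functions,
  \<open>\<langle>f m - g, \<mu> - m\<rangle> \<ge> 0\<close> for all \<open>\<mu> \<ge> 0\<close>, which is the inequality that defines \<open>m\<^sub>n\<close> from \<open>g\<^sub>n\<close>;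
  monotonicity of \<open>f\<close> then gives
  \<open>\<alpha> \<parallel>m\<^sub>n - m\<parallel>\<^sup>2 \<le> \<langle>g\<^sub>n - g, m\<^sub>n - m\<rangle>\<close> (\<open>cone_inequality_cocoercive\<close>).  On the set \<open>K\<close>,
  \<open>\<langle>m - w, h - g\<rangle> \<ge> 0\<close> for all \<open>h \<in> K\<close>, which says that \<open>g\<close> is the projection onto \<open>K\<close> of
  \<open>g - \<delta> (m - w)\<close>.  The projection does not increase distances, so
  \<open>\<parallel>g\<^sub>n\<^sub>+\<^sub>1 - g\<parallel>\<^sup>2 \<le> \<parallel>g\<^sub>n - g - \<delta> (m\<^sub>n - m)\<parallel>\<^sup>2 \<le> \<parallel>g\<^sub>n - g\<parallel>\<^sup>2 - \<delta> (2 \<alpha> - \<delta>) \<parallel>m\<^sub>n - m\<parallel>\<^sup>2\<close>.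
  Hence the decreasing sequence \<open>\<parallel>g\<^sub>n - g\<parallel>\<^sup>2\<close> converges and \<open>\<parallel>m\<^sub>n - m\<parallel>\<close> tends to 0.  The same two inequalities
  for two solutions give \<open>m = m'\<close>; the inequality for \<open>f m - L u\<close> on \<open>v \<le> 0\<close> is then an obstacle problem
  with the same data for \<open>u\<close> and \<open>u'\<close>, and it has only one solution.

  The projection and \<open>L\<^sup>-\<^sup>1\<close> exist because \<open>L\<^sup>2\<close> of the torus is complete: nearest points exist in
  complete convex sets (\<open>nearest_point_exists\<close>), and \<open>L\<^sup>-\<^sup>1\<close> comes from the Riesz representation in
  \<open>H\<^sup>1\<close> with the energy inner product (\<open>ex1_weak_solution\<close>).  The passage from the system to the two
  inequalities needs two facts about weak derivatives: integration by parts between two elements of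
  \<open>H\<^sup>1\<close> (\<open>has_weak_partial_by_parts\<close>), and that an element of \<open>L\<^sup>2\<close> is nonnegative if its integrals
  against nonnegative test functions are (\<open>nonneg_if_nonneg_on_test_functions\<close>).  Both follow by
  smoothing with nonnegative trigonometric kernels, whose convolutions converge weakly
  (\<open>conv_form_vp_kernel_tendsto\<close>).
\<close>

section \<open>Projections and representation of functionals in inner product spaces\<close>

lemma nearest_point_exists:
  fixes K :: "'a::real_inner set"
  assumes "complete K" "convex K" "K \<noteq> {}"
  obtains y where "y \<in> K" "\<And>z. z \<in> K \<Longrightarrow> dist x y \<le> dist x z"
proof -
  define d where "d = (INF z\<in>K. (norm (x - z))\<^sup>2)"
  have bdd: "bdd_below ((\<lambda>z. (norm (x - z))\<^sup>2) ` K)"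
    by (rule bdd_belowI[of _ 0]) auto
  have d_le: "d \<le> (norm (x - z))\<^sup>2" if "z \<in> K" for z
    unfolding d_def using bdd that by (rule cINF_lower)
  have "\<exists>z\<in>K. (norm (x - z))\<^sup>2 < d + 1 / real (Suc n)" for n
  proof -
    have "(INF z\<in>K. (norm (x - z))\<^sup>2) < d + 1 / real (Suc n)"
      unfolding d_def by simp
    then show ?thesis
      using bdd assms(3) by (simp add: cINF_less_iff)
  qed
  then obtain s where sK: "\<And>n. s n \<in> K"
    and s_lt: "\<And>n. (norm (x - s n))\<^sup>2 < d + 1 / real (Suc n)"
    by metis
  \<comment> \<open>The midpoint of \<open>s m\<close> and \<open>s n\<close> lies in \<open>K\<close>, so the parallelogram identity makes \<open>s\<close> a Cauchy sequence.\<close>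
  have close: "(norm (s m - s n))\<^sup>2 < 4 / real (Suc N)" if "m \<ge> N" "n \<ge> N" for m n N
  proof -
    let ?c = "(1/2) *\<^sub>R s m + (1/2) *\<^sub>R s n"
    have "?c \<in> K"
      using assms(2) sK by (intro convexD) auto
    then have "d \<le> (norm (x - ?c))\<^sup>2"
      by (rule d_le)
    moreover have "(norm (s m - s n))\<^sup>2 =
        2 * (norm (x - s m))\<^sup>2 + 2 * (norm (x - s n))\<^sup>2 - 4 * (norm (x - ?c))\<^sup>2"
      by (simp add: power2_norm_eq_inner inner_diff inner_add inner_commute algebra_simps)
    moreover have "1 / real (Suc m) \<le> 1 / real (Suc N)" "1 / real (Suc n) \<le> 1 / real (Suc N)"
      using that by (simp_all add: frac_le)
    ultimately show ?thesis
      using s_lt[of m] s_lt[of n] by simp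
  qed
  have "Cauchy s"
  proof (rule metric_CauchyI)
    fix e :: real assume "e > 0"
    then obtain N where N: "4 / e\<^sup>2 < real (Suc N)"
      by (metis reals_Archimedean2 less_Suc_eq of_nat_less_iff order_less_trans lessI)
    have "dist (s m) (s n) < e" if "m \<ge> N" "n \<ge> N" for m n
    proof -
      have "(norm (s m - s n))\<^sup>2 < 4 / real (Suc N)"
        using that by (rule close)
      also have "\<dots> < e\<^sup>2"
        using N \<open>e > 0\<close> by (simp add: field_simps)
      finally show ?thesis
        using \<open>e > 0\<close> by (simp add: dist_norm power2_less_imp_less)
    qed
    then show "\<exists>M. \<forall>m\<ge>M. \<forall>n\<ge>M. dist (s m) (s n) < e"
      by blast
  qed
  then obtain y where y: "y \<in> K" "s \<longlonglongrightarrow> y"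
    using assms(1) sK unfolding complete_def by blast
  have "(\<lambda>n. (norm (x - s n))\<^sup>2) \<longlonglongrightarrow> (norm (x - y))\<^sup>2"
    by (intro tendsto_intros y(2))
  moreover have "(\<lambda>n. d + 1 / real (Suc n)) \<longlonglongrightarrow> d + 0"
    by (intro tendsto_add tendsto_const) (rule LIMSEQ_Suc[OF lim_1_over_n])
  ultimately have "(norm (x - y))\<^sup>2 \<le> d + 0"
    by (rule LIMSEQ_le) (use s_lt less_imp_le in blast)
  then have "dist x y \<le> dist x z" if "z \<in> K" for z
    using d_le[OF that] unfolding dist_norm by (smt (verit) norm_ge_zero power2_le_imp_le)
  with y(1) show ?thesis
    by (rule that)
qed

lemma proj_on_props:
  fixes K :: "'a::real_inner set"
  assumes "complete K" "convex K" "K \<noteq> {}"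
  shows proj_on_in: "proj_on K x \<in> K"
    and proj_on_obtuse: "z \<in> K \<Longrightarrow> inner (x - proj_on K x) (z - proj_on K x) \<le> 0"
proof -
  have "closed K"
    using assms(1) by (rule complete_imp_closed)
  have "\<exists>!y. y \<in> K \<and> (\<forall>z\<in>K. dist x y \<le> dist x z)"
  proof (rule ex_ex1I)
    show "\<exists>y. y \<in> K \<and> (\<forall>z\<in>K. dist x y \<le> dist x z)"
      by (rule nearest_point_exists[OF assms, of x]) auto
    show "y = y'" if "y \<in> K \<and> (\<forall>z\<in>K. dist x y \<le> dist x z)"
      "y' \<in> K \<and> (\<forall>z\<in>K. dist x y' \<le> dist x z)" for y y'
      using any_closest_point_unique[OF assms(2) \<open>closed K\<close>, of y y' x] that by simp
  qed
  then have *: "proj_on K x \<in> K \<and> (\<forall>z\<in>K. dist x (proj_on K x) \<le> dist x z)"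
    unfolding proj_on_def by (rule theI')
  then show "proj_on K x \<in> K"
    by blast
  show "z \<in> K \<Longrightarrow> inner (x - proj_on K x) (z - proj_on K x) \<le> 0"
    using any_closest_point_dot[OF assms(2) \<open>closed K\<close>, of "proj_on K x" z x] * by simp
qed

text \<open>
  The hypothesis says that \<open>y\<close> is the projection of \<open>x'\<close>, in the form of the variational inequality
  that characterises it.
\<close>

lemma proj_on_nonexpansive_at:
  fixes K :: "'a::real_inner set"
  assumes "complete K" "convex K" "y \<in> K" and obtuse: "\<And>z. z \<in> K \<Longrightarrow> inner (x' - y) (z - y) \<le> 0"
  shows "norm (proj_on K x - y) \<le> norm (x - x')"
proof -
  have "K \<noteq> {}"
    using assms(3) by blast
  let ?p = "proj_on K x"
  have "inner (x - ?p) (y - ?p) \<le> 0"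
    using proj_on_obtuse[OF assms(1,2) \<open>K \<noteq> {}\<close> assms(3)] .
  moreover have "inner (x' - y) (?p - y) \<le> 0"
    using obtuse[OF proj_on_in[OF assms(1,2) \<open>K \<noteq> {}\<close>]] .
  ultimately have "(norm (?p - y))\<^sup>2 \<le> inner (x - x') (?p - y)"
    by (simp add: power2_norm_eq_inner inner_diff inner_commute algebra_simps)
  also have "\<dots> \<le> norm (x - x') * norm (?p - y)"
    by (rule norm_cauchy_schwarz)
  finally show ?thesis
    by (cases "norm (?p - y) = 0") (auto simp: power2_eq_square)
qed

lemma riesz_representation_complete_subspace:
  fixes V :: "'a::real_inner set"
  assumes V: "subspace V" "complete V"
    and add: "\<And>v w. v \<in> V \<Longrightarrow> w \<in> V \<Longrightarrow> l (v + w) = l v + l w"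
    and scale: "\<And>c v. v \<in> V \<Longrightarrow> l (c *\<^sub>R v) = c * l v"
    and bound: "\<And>v. v \<in> V \<Longrightarrow> \<bar>l v\<bar> \<le> C * norm v"
  shows "\<exists>w\<in>V. \<forall>v\<in>V. l v = inner w v"
proof (cases "\<forall>v\<in>V. l v = 0")
  case True
  with subspace_0[OF V(1)] show ?thesis
    by (intro bexI[of _ 0]) auto
next
  case False
  then obtain v0 where v0: "v0 \<in> V" "l v0 \<noteq> 0"
    by blast
  have diff: "l (v - w) = l v - l w" if "v \<in> V" "w \<in> V" for v w
    using add[of v "(-1) *\<^sub>R w"] scale[of w "-1"] that subspace_scale[OF V(1), of w "-1"] by simp
  define N where "N = {v \<in> V. l v = 0}"
  have N: "subspace N"
    unfolding N_def
    by (rule subspaceI) (use V(1) add scale scale[of 0 0] in \<open>auto simp: subspace_0 subspace_add subspace_scale\<close>)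
  have "complete N"
    unfolding complete_def
  proof (intro allI impI)
    fix s assume s: "(\<forall>n. s n \<in> N) \<and> Cauchy s"
    then obtain y where y: "y \<in> V" "s \<longlonglongrightarrow> y"
      using V(2) unfolding complete_def N_def by blast
    have "(\<lambda>n. C * norm (y - s n)) \<longlonglongrightarrow> C * norm (y - y)"
      by (intro tendsto_intros y(2))
    moreover have "\<bar>l y\<bar> \<le> C * norm (y - s n)" for n
    proof -
      have "s n \<in> V" "l (s n) = 0"
        using s by (auto simp: N_def)
      then show ?thesis
        using bound[of "y - s n"] diff[of y "s n"] y(1) V(1) by (simp add: subspace_diff)
    qed
    ultimately have "\<bar>l y\<bar> \<le> 0"
      using LIMSEQ_le_const by fastforce
    with y show "\<exists>l\<in>N. s \<longlonglongrightarrow> l"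
      by (auto simp: N_def)
  qed
  have ne: "N \<noteq> {}"
    using subspace_0[OF N] by blast
  define p where "p = proj_on N v0"
  have p: "p \<in> N"
    unfolding p_def by (rule proj_on_in[OF \<open>complete N\<close> subspace_imp_convex[OF N] ne])
  define e where "e = v0 - p"
  have eV: "e \<in> V" and le: "l e = l v0"
    using p v0 V(1) diff by (auto simp: e_def N_def subspace_diff)
  have orth: "inner e z = 0" if "z \<in> N" for z
  proof -
    have "inner e (p + c *\<^sub>R z - p) \<le> 0" for c
      unfolding e_def p_def
      by (rule proj_on_obtuse[OF \<open>complete N\<close> subspace_imp_convex[OF N] ne])
        (use p that N in \<open>auto simp: p_def subspace_add subspace_scale\<close>)
    from this[of 1] this[of "-1"] show ?thesis
      by simp
  qed
  have "e \<noteq> 0"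
    using le v0 scale[of 0 0] subspace_0[OF V(1)] by auto
  show ?thesis
  proof (intro bexI[of _ "(l e / inner e e) *\<^sub>R e"] ballI)
    show "(l e / inner e e) *\<^sub>R e \<in> V"
      using V(1) eV by (rule subspace_scale)
    fix v assume v: "v \<in> V"
    have "l (v - (l v / l e) *\<^sub>R e) = 0"
      using v eV V(1) le v0 by (simp add: diff scale subspace_scale)
    then have "v - (l v / l e) *\<^sub>R e \<in> N"
      using v eV V(1) by (simp add: N_def subspace_diff subspace_scale)
    then have "inner e v = (l v / l e) * inner e e"
      using orth by (fastforce simp: inner_diff_right)
    then show "l v = inner ((l e / inner e e) *\<^sub>R e) v"
      using \<open>e \<noteq> 0\<close> le v0 by simp
  qed
qed

section \<open>Measure, completeness and order on the torus\<close>

lemma space_torus: "space torus = cbox 0 1"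
  by (simp add: torus_def space_restrict_space)

lemma emeasure_torus: "emeasure (torus :: (real ^ 'd::finite) measure) (space torus) = 1"
proof -
  have "(\<Prod>b\<in>Basis. (1 - 0) \<bullet> (b :: real ^ 'd)) = 1"
    by (intro prod.neutral) (auto simp: Basis_vec_def inner_axis)
  then show ?thesis
    unfolding space_torus
    by (simp add: torus_def emeasure_restrict_space emeasure_lborel_cbox_eq Basis_vec_def inner_axis)
qed

interpretation torus: finite_measure "torus :: (real ^ 'd::finite) measure"
  by (rule finite_measureI) (simp add: emeasure_torus)

interpretation torus_pair: pair_sigma_finite "torus :: (real ^ 'd::finite) measure" "torus :: (real ^ 'd) measure" ..

lemma measure_torus: "measure (torus :: (real ^ 'd::finite) measure) (space torus) = 1"
  by (simp add: measure_def emeasure_torus)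

lemma square_integrable_1: "square_integrable (\<lambda>x. 1)"
  by (simp add: square_integrable_def)

lemma square_integrable_integrable:
  assumes "square_integrable f"
  shows "integrable torus f"
  using square_integrable_mult[OF assms square_integrable_1] by simp

lemma square_integrable_diff:
  assumes "square_integrable f" "square_integrable g"
  shows "square_integrable (\<lambda>x. f x - g x)"
  using square_integrable_add[OF assms(1) square_integrable_scale[OF assms(2), of "-1"]] by simp

lemma square_integrable_bound:
  assumes "square_integrable f" "g \<in> borel_measurable torus" "\<And>x. x \<in> space torus \<Longrightarrow> \<bar>g x\<bar> \<le> \<bar>f x\<bar>"
  shows "square_integrable g"
  unfolding square_integrable_def
proof (intro conjI)
  show "integrable torus (\<lambda>x. (g x)\<^sup>2)"
  proof (rule Bochner_Integration.integrable_bound)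
    show "integrable torus (\<lambda>x. (f x)\<^sup>2)"
      using assms(1) by (simp add: square_integrable_def)
    show "AE x in torus. norm ((g x)\<^sup>2) \<le> norm ((f x)\<^sup>2)"
      using assms(3) by (intro AE_I2) (simp add: power2_le_iff_abs_le abs_le_square_iff[symmetric])
  qed (use assms(2) in measurable)
qed fact

lemma torus_L2_rep:
  obtains f where "square_integrable f" "F = abs_torus_L2 f"
proof -
  have "\<exists>f. square_integrable f \<and> F = abs_torus_L2 f"
    by (induct F rule: torus_L2.abs_induct) auto
  with that show thesis
    by blast
qed

lemma inner_abs_torus_L2:
  assumes "square_integrable f" "square_integrable g"
  shows "inner (abs_torus_L2 f) (abs_torus_L2 g) = (\<integral>x. f x * g x \<partial>torus)"
  using assms by (simp add: inner_torus_L2.abs_eq)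

lemma le_abs_torus_L2:
  assumes "square_integrable f" "square_integrable g"
  shows "abs_torus_L2 f \<le> abs_torus_L2 g \<longleftrightarrow> (AE x in torus. f x \<le> g x)"
  using assms by (simp add: less_eq_torus_L2.abs_eq)

lemma diff_abs_torus_L2:
  assumes "square_integrable f" "square_integrable g"
  shows "abs_torus_L2 f - abs_torus_L2 g = abs_torus_L2 (\<lambda>x. f x - g x)"
proof -
  have "- abs_torus_L2 g = abs_torus_L2 (\<lambda>x. (-1) * g x)"
    using assms(2) unfolding uminus_torus_L2_def by (intro scaleR_torus_L2.abs_eq) auto
  then have "abs_torus_L2 f - abs_torus_L2 g = abs_torus_L2 f + abs_torus_L2 (\<lambda>x. (-1) * g x)"
    unfolding minus_torus_L2_def by (rule arg_cong)
  also have "\<dots> = abs_torus_L2 (\<lambda>x. f x + (-1) * g x)"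
    using assms square_integrable_scale[OF assms(2), of "-1"] by (intro plus_torus_L2.abs_eq) auto
  finally show ?thesis
    by simp
qed

lemma norm_abs_torus_L2:
  assumes "square_integrable f"
  shows "norm (abs_torus_L2 f) = sqrt (\<integral>x. (f x)\<^sup>2 \<partial>torus)"
  using assms by (simp add: norm_eq_sqrt_inner inner_abs_torus_L2 power2_eq_square)

lemma integral_abs_le_norm_torus_L2:
  assumes "square_integrable f"
  shows "(\<integral>x. \<bar>f x\<bar> \<partial>torus) \<le> norm (abs_torus_L2 f)"
proof -
  have abs: "square_integrable (\<lambda>x. \<bar>f x\<bar>)"
    using assms by (rule square_integrable_bound) (use assms in \<open>auto simp: square_integrable_def\<close>)
  have "(\<integral>x. \<bar>f x\<bar> \<partial>torus) = inner (abs_torus_L2 (\<lambda>x. \<bar>f x\<bar>)) (abs_torus_L2 (\<lambda>x. 1))"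
    using abs by (simp add: inner_abs_torus_L2 square_integrable_1)
  also have "\<dots> \<le> norm (abs_torus_L2 (\<lambda>x. \<bar>f x\<bar>)) * norm (abs_torus_L2 (\<lambda>x :: real ^ 'a. 1))"
    by (rule norm_cauchy_schwarz)
  also have "\<dots> = norm (abs_torus_L2 f)"
    using abs assms by (simp add: norm_abs_torus_L2 measure_torus square_integrable_1)
  finally show ?thesis .
qed

text \<open>A sequence whose consecutive distances are at most \<open>2\<^sup>-\<^sup>k\<close> converges almost everywhere.\<close>

lemma fast_Cauchy_AE_convergent:
  assumes f: "\<And>k. square_integrable (f k)"
    and fast: "\<And>k. norm (abs_torus_L2 (f (Suc k)) - abs_torus_L2 (f k)) \<le> (1/2) ^ k"
  shows "AE x in torus. convergent (\<lambda>k. f k x)"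
proof -
  have [measurable]: "f k \<in> borel_measurable torus" for k
    using f by (simp add: square_integrable_def)
  have int: "(\<integral>\<^sup>+x. ennreal \<bar>f (Suc k) x - f k x\<bar> \<partial>torus) \<le> ennreal ((1/2) ^ k)" for k
  proof -
    have sq: "square_integrable (\<lambda>x. f (Suc k) x - f k x)"
      using f by (intro square_integrable_diff)
    have "(\<integral>\<^sup>+x. ennreal \<bar>f (Suc k) x - f k x\<bar> \<partial>torus) = ennreal (\<integral>x. \<bar>f (Suc k) x - f k x\<bar> \<partial>torus)"
      using square_integrable_integrable[OF sq] by (intro nn_integral_eq_integral) auto
    also have "\<dots> \<le> ennreal ((1/2) ^ k)"
      using integral_abs_le_norm_torus_L2[OF sq] fast[of k] f
      by (intro ennreal_leI) (simp add: diff_abs_torus_L2)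
    finally show ?thesis .
  qed
  have "(\<integral>\<^sup>+x. (\<Sum>k. ennreal \<bar>f (Suc k) x - f k x\<bar>) \<partial>torus) =
      (\<Sum>k. \<integral>\<^sup>+x. ennreal \<bar>f (Suc k) x - f k x\<bar> \<partial>torus)"
    by (rule nn_integral_suminf) measurable
  also have "\<dots> \<le> (\<Sum>k. ennreal ((1/2) ^ k))"
    by (intro suminf_le int) auto
  also have "\<dots> < \<infinity>"
  proof -
    have "(\<Sum>k. ennreal ((1/2 :: real) ^ k)) \<noteq> top"
      by (rule ennreal_suminf_neq_top) (auto intro!: summable_geometric)
    then show ?thesis
      by (simp only: infinity_ennreal_def less_top)
  qed
  finally have "AE x in torus. (\<Sum>k. ennreal \<bar>f (Suc k) x - f k x\<bar>) \<noteq> \<infinity>"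
    by (intro nn_integral_PInf_AE) (auto simp: less_top)
  then show ?thesis
  proof eventually_elim
    case (elim x)
    then have "summable (\<lambda>k. \<bar>f (Suc k) x - f k x\<bar>)"
      by (intro summable_suminf_not_top) auto
    then have "summable (\<lambda>k. f (Suc k) x - f k x)"
      by (rule summable_rabs_cancel)
    then have "convergent (\<lambda>n. \<Sum>k<n. f (Suc k) x - f k x)"
      by (simp add: summable_iff_convergent)
    then have "convergent (\<lambda>n. f n x - f 0 x)"
      by (simp add: sum_lessThan_telescope[of "\<lambda>n. f n x"])
    from convergent_add[OF this convergent_const[of "f 0 x"]] show ?case
      by simp
  qed
qed

text \<open>Fatou's lemma turns almost everywhere convergence of a Cauchy sequence into \<open>L\<^sup>2\<close> convergence.\<close>

lemma Cauchy_AE_limit_torus_L2: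
  assumes f: "\<And>k. square_integrable (f k)"
    and cauchy: "Cauchy (\<lambda>k. abs_torus_L2 (f k))"
    and [measurable]: "g \<in> borel_measurable torus"
    and lim: "AE x in torus. (\<lambda>k. f k x) \<longlonglongrightarrow> g x"
  shows "square_integrable g" "(\<lambda>k. abs_torus_L2 (f k)) \<longlonglongrightarrow> abs_torus_L2 g"
proof -
  have [measurable]: "f k \<in> borel_measurable torus" for k
    using f by (simp add: square_integrable_def)
  have fatou: "(\<integral>\<^sup>+x. ennreal ((f k x - g x)\<^sup>2) \<partial>torus) \<le> ennreal (e\<^sup>2)"
    if "e > 0" and N: "\<And>j. j \<ge> N \<Longrightarrow> norm (abs_torus_L2 (f k) - abs_torus_L2 (f j)) \<le> e" for e N k
  proof -
    have sq: "square_integrable (\<lambda>x. f k x - f j x)" for j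
      using f by (intro square_integrable_diff)
    have le: "(\<integral>\<^sup>+x. ennreal ((f k x - f j x)\<^sup>2) \<partial>torus) \<le> ennreal (e\<^sup>2)" if "j \<ge> N" for j
    proof -
      have "(\<integral>\<^sup>+x. ennreal ((f k x - f j x)\<^sup>2) \<partial>torus) = ennreal (\<integral>x. (f k x - f j x)\<^sup>2 \<partial>torus)"
        using sq by (intro nn_integral_eq_integral) (auto simp: square_integrable_def)
      also have "(\<integral>x. (f k x - f j x)\<^sup>2 \<partial>torus) \<le> e\<^sup>2"
        using N[OF that] f \<open>e > 0\<close> sq
        by (simp add: diff_abs_torus_L2 norm_abs_torus_L2 real_sqrt_le_iff' real_le_lsqrt sqrt_le_D)
      finally show ?thesis
        by (simp add: ennreal_leI)
    qed
    have "(\<integral>\<^sup>+x. ennreal ((f k x - g x)\<^sup>2) \<partial>torus) =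
        (\<integral>\<^sup>+x. liminf (\<lambda>j. ennreal ((f k x - f j x)\<^sup>2)) \<partial>torus)"
    proof (rule nn_integral_cong_AE)
      show "AE x in torus. ennreal ((f k x - g x)\<^sup>2) = liminf (\<lambda>j. ennreal ((f k x - f j x)\<^sup>2))"
        using lim
      proof eventually_elim
        case (elim x)
        then have "(\<lambda>j. ennreal ((f k x - f j x)\<^sup>2)) \<longlonglongrightarrow> ennreal ((f k x - g x)\<^sup>2)"
          by (intro tendsto_intros)
        then show ?case
          by (intro lim_imp_Liminf[symmetric]) auto
      qed
    qed
    also have "\<dots> \<le> liminf (\<lambda>j. \<integral>\<^sup>+x. ennreal ((f k x - f j x)\<^sup>2) \<partial>torus)"
      by (rule nn_integral_liminf) measurable
    also have "\<dots> \<le> ennreal (e\<^sup>2)"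
    proof (rule Liminf_le)
      show "\<forall>\<^sub>F j in sequentially. (\<integral>\<^sup>+x. ennreal ((f k x - f j x)\<^sup>2) \<partial>torus) \<le> ennreal (e\<^sup>2)"
        using eventually_ge_at_top[of N] by eventually_elim (rule le)
    qed simp
    finally show ?thesis .
  qed
  have ex_N: "\<exists>N. \<forall>k\<ge>N. \<forall>j\<ge>N. norm (abs_torus_L2 (f k) - abs_torus_L2 (f j)) \<le> e" if e: "e > 0" for e
      proof -
    obtain M where "\<And>k j. k \<ge> M \<Longrightarrow> j \<ge> M \<Longrightarrow> norm (abs_torus_L2 (f k) - abs_torus_L2 (f j)) < e"
      using CauchyD[OF cauchy e] by auto
    then show ?thesis
      by (intro exI[of _ M]) (auto intro: less_imp_le)
  qed
  have sq_diff: "square_integrable (\<lambda>x. f k x - g x)"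
    if "(\<integral>\<^sup>+x. ennreal ((f k x - g x)\<^sup>2) \<partial>torus) \<le> ennreal c" for k c
    unfolding square_integrable_def
  proof (intro conjI)
    show "integrable torus (\<lambda>x. (f k x - g x)\<^sup>2)"
    proof (rule integrableI_bounded)
      show "(\<integral>\<^sup>+x. ennreal (norm ((f k x - g x)\<^sup>2)) \<partial>torus) < \<infinity>"
        using order_le_less_trans[OF that ennreal_less_top] by simp
    qed measurable
  qed measurable
  show "square_integrable g"
  proof -
    obtain N where "\<forall>k\<ge>N. \<forall>j\<ge>N. norm (abs_torus_L2 (f k) - abs_torus_L2 (f j)) \<le> 1"
      using ex_N[of 1] by auto
    then have "square_integrable (\<lambda>x. f N x - g x)"
      by (intro sq_diff[of N "1\<^sup>2"] fatou[of 1 N]) auto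
    from square_integrable_diff[OF f[of N] this] show ?thesis
      by simp
  qed
  show "(\<lambda>k. abs_torus_L2 (f k)) \<longlonglongrightarrow> abs_torus_L2 g"
  proof (rule LIMSEQ_I)
    fix r :: real assume "r > 0"
    then obtain N where N: "\<forall>k\<ge>N. \<forall>j\<ge>N. norm (abs_torus_L2 (f k) - abs_torus_L2 (f j)) \<le> r / 2"
      using ex_N[of "r/2"] by auto
    have "norm (abs_torus_L2 (f k) - abs_torus_L2 g) < r" if "k \<ge> N" for k
    proof -
      have *: "(\<integral>\<^sup>+x. ennreal ((f k x - g x)\<^sup>2) \<partial>torus) \<le> ennreal ((r / 2)\<^sup>2)"
        using N that \<open>r > 0\<close> by (intro fatou[of _ N]) auto
      have sq: "square_integrable (\<lambda>x. f k x - g x)"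
        using * by (rule sq_diff)
      then have "(\<integral>\<^sup>+x. ennreal ((f k x - g x)\<^sup>2) \<partial>torus) = ennreal (\<integral>x. (f k x - g x)\<^sup>2 \<partial>torus)"
        by (intro nn_integral_eq_integral) (auto simp: square_integrable_def)
      with * have "(\<integral>x. (f k x - g x)\<^sup>2 \<partial>torus) \<le> (r / 2)\<^sup>2"
        by (simp add: ennreal_le_iff)
      then have "sqrt (\<integral>x. (f k x - g x)\<^sup>2 \<partial>torus) \<le> r / 2"
        using \<open>r > 0\<close> by (intro real_le_lsqrt) auto
      then have "norm (abs_torus_L2 (f k) - abs_torus_L2 g) \<le> r / 2"
        using f \<open>square_integrable g\<close> sq by (simp only: diff_abs_torus_L2 norm_abs_torus_L2)
      with \<open>r > 0\<close> show ?thesis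
        by simp
    qed
    then show "\<exists>no. \<forall>n\<ge>no. norm (abs_torus_L2 (f n) - abs_torus_L2 g) < r"
      by blast
  qed
qed

text \<open>The Riesz-Fischer theorem: a fast subsequence has an almost everywhere limit, which is the limit in \<open>L\<^sup>2\<close>.\<close>

instance torus_L2 :: (finite) banach
proof
  fix X :: "nat \<Rightarrow> 'a torus_L2"
  assume X: "Cauchy X"
  have "\<exists>r :: nat \<Rightarrow> nat. \<forall>k. (\<forall>m\<ge>r k. norm (X m - X (r k)) \<le> (1/2) ^ k) \<and> r k < r (Suc k)"
  proof (rule dependent_nat_choice)
    have "\<exists>r > a. \<forall>m\<ge>r. norm (X m - X r) \<le> (1/2) ^ k" for a :: nat and k :: nat
    proof -
      obtain M where M: "\<And>m n. m \<ge> M \<Longrightarrow> n \<ge> M \<Longrightarrow> norm (X m - X n) < (1/2) ^ k"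
        using CauchyD[OF X, of "(1/2) ^ k"] by auto
      then show ?thesis
        by (intro exI[of _ "Suc (max a M)"]) (auto intro!: less_imp_le)
    qed
    then show "\<exists>r. \<forall>m\<ge>r. norm (X m - X r) \<le> (1/2) ^ 0"
      and "\<exists>y. (\<forall>m\<ge>y. norm (X m - X y) \<le> (1/2) ^ Suc k) \<and> a < y" for a k
      by blast+
  qed
  then obtain r :: "nat \<Rightarrow> nat" where r: "\<And>k m. m \<ge> r k \<Longrightarrow> norm (X m - X (r k)) \<le> (1/2) ^ k"
    and r_less: "\<And>k. r k < r (Suc k)"
    by blast
  have "strict_mono r"
    using r_less by (simp add: strict_mono_Suc_iff)
  have "\<exists>f. square_integrable f \<and> X (r k) = abs_torus_L2 f" for k
    by (rule torus_L2_rep[of "X (r k)"]) auto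
  then obtain f where f: "\<And>k. square_integrable (f k)" and X_f: "\<And>k. X (r k) = abs_torus_L2 (f k)"
    by metis
  have [measurable]: "f k \<in> borel_measurable torus" for k
    using f by (simp add: square_integrable_def)
  have "Cauchy (\<lambda>k. abs_torus_L2 (f k))"
    using Cauchy_subseq_Cauchy[OF X \<open>strict_mono r\<close>] by (simp add: comp_def X_f)
  moreover have "AE x in torus. convergent (\<lambda>k. f k x)"
    using f r[OF less_imp_le[OF r_less]] by (intro fast_Cauchy_AE_convergent) (simp_all add: X_f)
  then have "AE x in torus. (\<lambda>k. f k x) \<longlonglongrightarrow> lim (\<lambda>k. f k x)"
    by (simp add: convergent_LIMSEQ_iff)
  ultimately have "(\<lambda>k. abs_torus_L2 (f k)) \<longlonglongrightarrow> abs_torus_L2 (\<lambda>x. lim (\<lambda>k. f k x))"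
    using f by (intro Cauchy_AE_limit_torus_L2(2)) auto
  then have sub: "(X \<circ> r) \<longlonglongrightarrow> abs_torus_L2 (\<lambda>x. lim (\<lambda>k. f k x))"
    by (simp add: comp_def X_f)
  show "convergent X"
    using Cauchy_converges_subseq[OF X \<open>strict_mono r\<close> sub] by (rule convergentI)
qed

instance torus_L2 :: (finite) ordered_real_vector
proof
  fix f g h :: "'a torus_L2" and a b :: real
  show "f \<le> g \<Longrightarrow> h + f \<le> h + g"
    by transfer auto
  show "f \<le> g \<Longrightarrow> 0 \<le> a \<Longrightarrow> a *\<^sub>R f \<le> a *\<^sub>R g"
    by transfer (auto intro: mult_left_mono)
  show "a \<le> b \<Longrightarrow> 0 \<le> f \<Longrightarrow> a *\<^sub>R f \<le> b *\<^sub>R f"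
    by transfer (auto intro: mult_right_mono)
qed

lemma inner_nonneg_torus_L2:
  fixes F P :: "'d::finite torus_L2"
  shows "0 \<le> F \<Longrightarrow> 0 \<le> P \<Longrightarrow> 0 \<le> inner F P"
proof transfer
  fix f p :: "real ^ 'd \<Rightarrow> real"
  assume "AE x in torus. 0 \<le> f x" "AE x in torus. 0 \<le> p x"
  then have "AE x in torus. 0 \<le> f x * p x"
    by eventually_elim simp
  then show "0 \<le> (\<integral>x. f x * p x \<partial>torus)"
    by (rule integral_nonneg_AE)
qed

text \<open>The cone of nonnegative functions is its own dual; in particular it is closed.\<close>

lemma nonneg_iff_inner_torus_L2:
  fixes F :: "'d::finite torus_L2"
  shows "0 \<le> F \<longleftrightarrow> (\<forall>P\<ge>0. 0 \<le> inner F P)"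
proof
  assume *: "\<forall>P\<ge>0. 0 \<le> inner F P"
  obtain f where f: "square_integrable f" and F: "F = abs_torus_L2 f"
    by (rule torus_L2_rep)
  \<comment> \<open>Testing against the negative part shows that it vanishes.\<close>
  define p where "p = (\<lambda>x. max 0 (- f x))"
  have p: "square_integrable p"
    using f by (rule square_integrable_bound) (use f in \<open>auto simp: square_integrable_def p_def\<close>)
  have "abs_torus_L2 p \<ge> 0"
    using p by (simp add: zero_torus_L2_def le_abs_torus_L2 square_integrable_0) (simp add: p_def)
  then have "0 \<le> inner F (abs_torus_L2 p)"
    using * by blast
  also have "\<dots> = (\<integral>x. f x * p x \<partial>torus)"
    using f p by (simp add: F inner_abs_torus_L2)
  also have "\<dots> = - (\<integral>x. (p x)\<^sup>2 \<partial>torus)"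
    unfolding Bochner_Integration.integral_minus[symmetric]
    by (intro Bochner_Integration.integral_cong) (auto simp: p_def max_def power2_eq_square)
  finally have "(\<integral>x. (p x)\<^sup>2 \<partial>torus) = 0"
    by (smt (verit) integral_nonneg_AE AE_I2 zero_le_power2)
  then have "AE x in torus. (p x)\<^sup>2 = 0"
    using p by (subst (asm) integral_nonneg_eq_0_iff_AE) (auto simp: square_integrable_def)
  then have "AE x in torus. 0 \<le> f x"
    by eventually_elim (auto simp: p_def)
  then show "0 \<le> F"
    using f by (simp add: F zero_torus_L2_def le_abs_torus_L2 square_integrable_0)
qed (use inner_nonneg_torus_L2 in blast)

lemma nonpos_limit_torus_L2:
  fixes F :: "'d::finite torus_L2"
  assumes "\<And>n. X n \<le> 0" "X \<longlonglongrightarrow> F"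
  shows "F \<le> 0"
proof -
  have "0 \<le> inner (- F) P" if "0 \<le> P" for P
  proof (rule LIMSEQ_le_const)
    show "(\<lambda>n. inner (- X n) P) \<longlonglongrightarrow> inner (- F) P"
      by (intro tendsto_intros assms(2))
    show "\<exists>N. \<forall>n\<ge>N. 0 \<le> inner (- X n) P"
      using assms(1) that by (intro exI[of _ 0] allI impI inner_nonneg_torus_L2) auto
  qed
  then have "0 \<le> - F"
    by (subst nonneg_iff_inner_torus_L2) blast
  then show ?thesis
    by simp
qed

section \<open>Periodic test functions\<close>

lemma C1_periodic_continuous:
  assumes "C1_periodic \<phi> G"
  shows "continuous_on UNIV \<phi>" "continuous_on UNIV (\<lambda>x. G x $ i)"
  using assms unfolding C1_periodic_def gderiv_def
  by (meson continuous_at_imp_continuous_on has_derivative_continuous,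
      auto intro!: continuous_intros)

lemma C1_periodic_const: "C1_periodic (\<lambda>x. c) (\<lambda>x. 0)"
  by (simp add: C1_periodic_def GDERIV_const)

lemma C1_periodic_mult:
  assumes "C1_periodic \<phi> G" "C1_periodic \<psi> H"
  shows "C1_periodic (\<lambda>x. \<phi> x * \<psi> x) (\<lambda>x. \<phi> x *\<^sub>R H x + \<psi> x *\<^sub>R G x)"
  using assms C1_periodic_continuous(1)[OF assms(1)] C1_periodic_continuous(1)[OF assms(2)]
  unfolding C1_periodic_def by (auto intro!: GDERIV_mult continuous_intros)

lemma C1_periodic_translate:
  assumes "C1_periodic \<phi> G"
  shows "C1_periodic (\<lambda>x. \<phi> (x - y)) (\<lambda>x. G (x - y))"
  unfolding C1_periodic_def
proof (intro conjI allI)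
  have G: "FDERIV \<phi> x :> (\<lambda>h. inner h (G x))" and per: "\<phi> (x + axis i 1) = \<phi> x" for x i
    using assms by (auto simp: C1_periodic_def gderiv_def)
  fix x i
  show "\<phi> (x + axis i 1 - y) = \<phi> (x - y)"
    using per[of "x - y" i] by (simp add: algebra_simps)
  have "FDERIV (\<lambda>x. \<phi> (x - y)) x :> (\<lambda>h. inner h (G (x - y)))"
    by (rule has_derivative_compose[OF _ G]) (auto intro!: derivative_eq_intros)
  then show "GDERIV (\<lambda>x. \<phi> (x - y)) x :> G (x - y)"
    by (simp add: gderiv_def)
next
  show "continuous_on UNIV (\<lambda>x. G (x - y))"
    by (rule continuous_on_compose2[of UNIV G]) (use assms in \<open>auto simp: C1_periodic_def intro!: continuous_intros\<close>)
qed

lemma C1_periodic_reflect: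
  assumes "C1_periodic \<phi> G"
  shows "C1_periodic (\<lambda>y. \<phi> (x - y)) (\<lambda>y. - G (x - y))"
  unfolding C1_periodic_def
proof (intro conjI allI)
  have G: "FDERIV \<phi> x :> (\<lambda>h. inner h (G x))" and per: "\<phi> (x + axis i 1) = \<phi> x" for x i
    using assms by (auto simp: C1_periodic_def gderiv_def)
  fix y i
  show "\<phi> (x - (y + axis i 1)) = \<phi> (x - y)"
    using per[of "x - y - axis i 1" i] by (simp add: algebra_simps)
  have "FDERIV (\<lambda>y. \<phi> (x - y)) y :> (\<lambda>h. inner (- h) (G (x - y)))"
    by (rule has_derivative_compose[OF _ G]) (auto intro!: derivative_eq_intros)
  then show "GDERIV (\<lambda>y. \<phi> (x - y)) y :> - G (x - y)"
    by (simp add: gderiv_def)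
next
  show "continuous_on UNIV (\<lambda>y. - G (x - y))"
    by (rule continuous_on_minus, rule continuous_on_compose2[of UNIV G])
      (use assms in \<open>auto simp: C1_periodic_def intro!: continuous_intros\<close>)
qed

lemma C1_periodic_coordinate:
  fixes f f' :: "real \<Rightarrow> real" and i :: "'d::finite"
  assumes "\<And>t. (f has_real_derivative f' t) (at t)" "continuous_on UNIV f'" "\<And>t. f (t + 1) = f t"
  shows "C1_periodic (\<lambda>x. f (x $ i)) (\<lambda>x. f' (x $ i) *\<^sub>R axis i 1)"
  unfolding C1_periodic_def
proof (intro conjI allI)
  fix x :: "real ^ 'd" and j
  show "f ((x + axis j 1) $ i) = f (x $ i)"
    using assms(3) by (simp add: axis_def)
  have "FDERIV (\<lambda>x. f (x $ i)) x :> (\<lambda>h. f' (x $ i) * h $ i)"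
    by (rule has_derivative_compose[OF bounded_linear_imp_has_derivative[OF bounded_linear_vec_nth]
          assms(1)[unfolded has_field_derivative_def]])
  then show "GDERIV (\<lambda>x. f (x $ i)) x :> f' (x $ i) *\<^sub>R axis i 1"
    by (simp add: gderiv_def inner_axis)
next
  show "continuous_on UNIV (\<lambda>x. f' (x $ i) *\<^sub>R axis i (1 :: real))"
    by (intro continuous_on_scaleR continuous_on_compose2[OF assms(2)]) (auto intro!: continuous_intros)
qed

lemma C1_periodic_prod:
  assumes "finite I" "\<And>i. i \<in> I \<Longrightarrow> \<exists>G. C1_periodic (\<phi> i) G"
  shows "\<exists>G. C1_periodic (\<lambda>x. \<Prod>i\<in>I. \<phi> i x) G"
  using assms
proof (induction I)
  case empty
  show ?case
    using C1_periodic_const[of 1] by auto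
next
  case (insert i I)
  obtain H where H: "C1_periodic (\<lambda>x. \<Prod>i\<in>I. \<phi> i x) H"
    using insert.IH insert.prems by blast
  obtain G where "C1_periodic (\<phi> i) G"
    using insert.prems by blast
  from C1_periodic_mult[OF this H] show ?case
    using insert.hyps by auto
qed

section \<open>An approximate identity of trigonometric kernels\<close>

text \<open>The mean of \<open>cos\<^sup>2\<^sup>n\<close> over a period, as given by the Wallis recursion.\<close>

definition cos_power_mean :: "nat \<Rightarrow> real" where
  "cos_power_mean n = (\<Prod>k<n. (2 * real k + 1) / (2 * real k + 2))"

lemma cos_power_mean_pos: "cos_power_mean n > 0"
  by (auto simp: cos_power_mean_def intro!: prod_pos)

lemma cos_power_mean_Suc:
  "cos_power_mean (Suc n) = cos_power_mean n * ((2 * real n + 1) / (2 * real n + 2))"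
  by (simp add: cos_power_mean_def)

lemma has_integral_cos_power:
  "((\<lambda>t. cos (pi * (a - t)) ^ (2 * n)) has_integral cos_power_mean n) {0..1}"
proof (induction n)
  case 0
  show ?case
    using has_integral_const_real[of "1 :: real" 0 1] by (simp add: cos_power_mean_def)
next
  case (Suc n)
  let ?c = "\<lambda>t. cos (pi * (a - t))" and ?s = "\<lambda>t. sin (pi * (a - t))"
  let ?D = "\<lambda>t. pi * ((2 * real n + 1) * ?c t ^ (2 * n) - (2 * real n + 2) * ?c t ^ (2 * n + 2))"
  \<comment> \<open>The primitive has period 1, so its derivative integrates to 0.\<close>
  have "(?D has_integral (?c 1 ^ Suc (2 * n) * ?s 1 - ?c 0 ^ Suc (2 * n) * ?s 0)) {0..1}"
  proof (rule fundamental_theorem_of_calculus)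
    fix t :: real
    have s2: "?s t * ?s t = 1 - ?c t * ?c t"
      using sin_squared_eq[of "pi * (a - t)"] by (simp add: power2_eq_square)
    have dc: "(?c has_real_derivative (?s t * pi)) (at t within {0..1})"
      and ds: "(?s has_real_derivative (- ?c t * pi)) (at t within {0..1})"
      by (auto intro!: derivative_eq_intros)
    note DERIV_mult[OF DERIV_power_Suc[OF dc, of "2 * n"] ds]
    also have "(1 + real (2 * n)) * (?s t * pi * ?c t ^ (2 * n)) * ?s t + - ?c t * pi * ?c t ^ Suc (2 * n)
        = (1 + real (2 * n)) * ?c t ^ (2 * n) * pi * (?s t * ?s t) - pi * ?c t ^ (2 * n + 2)"
      by (simp add: algebra_simps)
    also have "\<dots> = ?D t"
      unfolding s2 by (simp add: algebra_simps power_add power2_eq_square)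
    finally show "((\<lambda>t. ?c t ^ Suc (2 * n) * ?s t) has_vector_derivative ?D t) (at t within {0..1})"
      by (simp add: has_real_derivative_iff_has_vector_derivative)
  qed simp
  moreover have "?c 1 ^ Suc (2 * n) * ?s 1 = ?c 0 ^ Suc (2 * n) * ?s 0"
  proof -
    have "?c 1 = - ?c 0" "?s 1 = - ?s 0"
      by (simp_all add: right_diff_distrib cos_diff sin_diff)
    then show ?thesis
      by simp
  qed
  ultimately have D: "(?D has_integral 0) {0..1}"
    by simp
  have "((\<lambda>t. ((2 * real n + 1) * ?c t ^ (2 * n) - ?D t / pi) / (2 * real n + 2)) has_integral
      ((2 * real n + 1) * cos_power_mean n - 0 / pi) / (2 * real n + 2)) {0..1}"
    by (intro has_integral_divide has_integral_diff has_integral_mult_right Suc.IH D)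
  moreover have "((2 * real n + 1) * ?c t ^ (2 * n) - ?D t / pi) / (2 * real n + 2) = ?c t ^ (2 * Suc n)" for t
  proof -
    have "(2 * real n + 1) * ?c t ^ (2 * n) - ?D t / pi = (2 * real n + 2) * ?c t ^ (2 * n + 2)"
      by simp
    then show ?thesis
      by simp
  qed
  ultimately show ?case
    by (simp add: cos_power_mean_Suc mult.commute)
qed

text \<open>
  The product of the normalised kernels \<open>cos\<^sup>2\<^sup>n (\<pi> t)\<close> in each coordinate (the de la Vallee Poussin
  kernel).  It is nonnegative, has mean 1 and concentrates at the lattice points.
\<close>

definition vp_kernel :: "nat \<Rightarrow> real ^ 'd::finite \<Rightarrow> real" where
  "vp_kernel n z = (\<Prod>i\<in>UNIV. cos (pi * z $ i) ^ (2 * n) / cos_power_mean n)"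

lemma vp_kernel_nonneg: "vp_kernel n z \<ge> 0"
  unfolding vp_kernel_def
  by (intro prod_nonneg ballI divide_nonneg_pos cos_power_mean_pos) (simp add: power_mult)

lemma vp_kernel_minus_commute: "vp_kernel n (x - y) = vp_kernel n (y - x)"
proof -
  have "cos (pi * (x $ i - y $ i)) = cos (pi * (y $ i - x $ i))" for i
    using cos_minus[of "pi * (x $ i - y $ i)"] by (simp add: right_diff_distrib)
  then show ?thesis
    by (simp add: vp_kernel_def)
qed

lemma C1_periodic_vp_kernel: "\<exists>G. C1_periodic (vp_kernel n :: real ^ 'd::finite \<Rightarrow> real) G"
proof -
  have "C1_periodic (\<lambda>z. cos (pi * z $ i) ^ (2 * n) / cos_power_mean n)
      (\<lambda>z. (real (2 * n) * cos (pi * z $ i) ^ (2 * n - 1) * (- sin (pi * z $ i) * pi) / cos_power_mean n)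
        *\<^sub>R axis i 1)" for i :: 'd
  proof (rule C1_periodic_coordinate)
    have pos: "cos_power_mean n \<noteq> 0"
      using cos_power_mean_pos[of n] by simp
    fix t :: real
    show "((\<lambda>t. cos (pi * t) ^ (2 * n) / cos_power_mean n) has_real_derivative
        real (2 * n) * cos (pi * t) ^ (2 * n - 1) * (- sin (pi * t) * pi) / cos_power_mean n) (at t)"
      using pos by (auto intro!: derivative_eq_intros)
    have "cos (pi * (t + 1)) = - cos (pi * t)"
      by (simp add: distrib_left)
    then show "cos (pi * (t + 1)) ^ (2 * n) / cos_power_mean n = cos (pi * t) ^ (2 * n) / cos_power_mean n"
      by simp
    show "continuous_on UNIV
        (\<lambda>t. real (2 * n) * cos (pi * t) ^ (2 * n - 1) * (- sin (pi * t) * pi) / cos_power_mean n)"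
      using pos by (auto intro!: continuous_intros)
  qed
  then have "\<exists>G. C1_periodic (\<lambda>z. cos (pi * z $ i) ^ (2 * n) / cos_power_mean n) G" for i :: 'd
    by blast
  then show ?thesis
    unfolding vp_kernel_def[abs_def] by (intro C1_periodic_prod finite)
qed

lemma continuous_on_vp_kernel: "continuous_on UNIV (vp_kernel n :: real ^ 'd::finite \<Rightarrow> real)"
  using C1_periodic_vp_kernel C1_periodic_continuous(1) by metis

lemma integral_torus_prod:
  fixes h :: "'d::finite \<Rightarrow> real \<Rightarrow> real"
  assumes cont: "\<And>i. continuous_on UNIV (h i)" and nonneg: "\<And>i t. 0 \<le> h i t"
  shows "(\<integral>y. (\<Prod>i\<in>UNIV. h i (y $ i)) \<partial>torus) = (\<Prod>i\<in>UNIV. integral {0..1} (h i))"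
proof -
  have [measurable]: "h i \<in> borel_measurable borel" for i
    using cont by (rule borel_measurable_continuous_onI)
  have [measurable]: "(\<lambda>y :: real ^ 'd. y $ i) \<in> borel_measurable borel" for i
    by (intro borel_measurable_continuous_onI continuous_intros)
  have one: "(\<integral>\<^sup>+t. ennreal (h i t) * indicator {0..1} t \<partial>lborel) = ennreal (integral {0..1} (h i))" for i
  proof -
    have "(h i has_integral integral {0..1} (h i)) {0..1}"
      using continuous_on_subset[OF cont[of i], of "{0..1}"] by (intro integrable_integral integrable_continuous_real) auto
    then show ?thesis
      using nonneg by (intro nn_integral_has_integral_lebesgue') auto
  qed
  let ?e = "\<lambda>i. axis i 1 :: real ^ 'd"
  have Basis: "Basis = range ?e"
    by (auto simp: Basis_vec_def)
  have inj: "inj ?e"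
    by (auto intro: injI simp: axis_eq_axis)
  define h' where "h' = (\<lambda>b t. ennreal (h (inv ?e b) t) * indicator {0..1} t)"
  have h': "h' (?e i) t = ennreal (h i t) * indicator {0..1} t" for i t
    by (simp add: h'_def inv_f_f[OF inj])
  have int_h': "integral\<^sup>N lborel (h' (?e i)) = ennreal (integral {0..1} (h i))" for i
    unfolding one[symmetric] by (intro nn_integral_cong) (rule h')
  have ind: "indicator (cbox 0 1) y = (\<Prod>i\<in>UNIV. indicator {0..1} (y $ i) :: ennreal)" for y :: "real ^ 'd"
  proof (cases "y \<in> cbox 0 1")
    case False
    then obtain i where "indicator {0..1} (y $ i) = (0 :: ennreal)"
      by (auto simp: mem_box_cart indicator_def)
    with False show ?thesis
      by (simp add: prod_zero_iff) metis
  qed (auto simp: mem_box_cart)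
  have "(\<integral>\<^sup>+y. ennreal (\<Prod>i\<in>UNIV. h i (y $ i)) \<partial>torus) =
      (\<integral>\<^sup>+y. ennreal (\<Prod>i\<in>UNIV. h i (y $ i)) * indicator (cbox 0 1) y \<partial>lborel)"
    unfolding torus_def by (subst nn_integral_restrict_space) auto
  also have "\<dots> = (\<integral>\<^sup>+y. (\<Prod>b\<in>Basis. h' b (y \<bullet> b)) \<partial>lborel)"
    using nonneg
    by (intro nn_integral_cong) (simp add: Basis prod.reindex[OF inj] h' ind inner_axis prod.distrib prod_ennreal)
  also have "\<dots> = (\<Prod>b\<in>Basis. \<integral>\<^sup>+t. h' b t \<partial>lborel)"
    by (rule nn_integral_lborel_prod) (auto simp: h'_def)
  also have "\<dots> = (\<Prod>i\<in>UNIV. ennreal (integral {0..1} (h i)))"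
    by (simp add: Basis prod.reindex[OF inj] int_h')
  also have "\<dots> = ennreal (\<Prod>i\<in>UNIV. integral {0..1} (h i))"
    using nonneg by (intro prod_ennreal Henstock_Kurzweil_Integration.integral_nonneg integrable_continuous_real
        continuous_on_subset[OF cont]) auto
  finally have nn: "(\<integral>\<^sup>+y. ennreal (\<Prod>i\<in>UNIV. h i (y $ i)) \<partial>torus) = ennreal (\<Prod>i\<in>UNIV. integral {0..1} (h i))" .
  have [measurable]: "(\<lambda>y. \<Prod>i\<in>UNIV. h i (y $ i)) \<in> borel_measurable torus"
    unfolding torus_def by (intro measurable_restrict_space1) measurable
  have "0 \<le> (\<Prod>i\<in>UNIV. integral {0..1} (h i))"
    using nonneg by (intro prod_nonneg ballI Henstock_Kurzweil_Integration.integral_nonneg integrable_continuous_real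
        continuous_on_subset[OF cont]) auto
  with nn show ?thesis
    using nonneg by (subst integral_eq_nn_integral) (auto intro: prod_nonneg)
qed

lemma integral_vp_kernel:
  "(\<integral>y. vp_kernel n (x - y) \<partial>torus) = 1"
proof -
  have "integral {0..1} (\<lambda>t. cos (pi * (x $ i - t)) ^ (2 * n) / cos_power_mean n) = 1" for i
    by (rule integral_unique)
      (use has_integral_divide[OF has_integral_cos_power[of "x $ i" n], of "cos_power_mean n"]
        cos_power_mean_pos[of n] in simp)
  then show ?thesis
    unfolding vp_kernel_def vector_minus_component
    using integral_torus_prod[of "\<lambda>i t. cos (pi * (x $ i - t)) ^ (2 * n) / cos_power_mean n"]
      cos_power_mean_pos[of n]
    by (simp add: power_mult continuous_intros less_imp_le)
qed

lemma integral_vp_kernel_sin: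
  fixes x :: "real ^ 'd::finite"
  shows "(\<integral>y. vp_kernel n (x - y) * (sin (pi * (x $ j - y $ j)))\<^sup>2 \<partial>torus) = 1 / (2 * real n + 2)"
proof -
  let ?c = "cos_power_mean"
  define h where "h i t = cos (pi * (x $ i - t)) ^ (2 * n) / ?c n *
      (if i = j then (sin (pi * (x $ j - t)))\<^sup>2 else 1)" for i t
  have int: "integral {0..1} (h i) = (if i = j then 1 / (2 * real n + 2) else 1)" for i
  proof (cases "i = j")
    case True
    have "h i = (\<lambda>t. (cos (pi * (x $ i - t)) ^ (2 * n) - cos (pi * (x $ i - t)) ^ (2 * Suc n)) / ?c n)"
    proof
      fix t
      have "h i t = cos (pi * (x $ i - t)) ^ (2 * n) / ?c n * (1 - (cos (pi * (x $ i - t)))\<^sup>2)"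
        using True by (simp add: h_def sin_squared_eq)
      also have "\<dots> = (cos (pi * (x $ i - t)) ^ (2 * n) - cos (pi * (x $ i - t)) ^ (2 * Suc n)) / ?c n"
        by (simp add: right_diff_distrib diff_divide_distrib power_add power2_eq_square)
      finally show "h i t = (cos (pi * (x $ i - t)) ^ (2 * n) - cos (pi * (x $ i - t)) ^ (2 * Suc n)) / ?c n" .
    qed
    then have "(h i has_integral (?c n - ?c (Suc n)) / ?c n) {0..1}"
      by (simp only:) (intro has_integral_divide has_integral_diff has_integral_cos_power)
    moreover have "(?c n - ?c (Suc n)) / ?c n = 1 / (2 * real n + 2)"
    proof -
      have "(?c n - ?c (Suc n)) / ?c n = 1 - (2 * real n + 1) / (2 * real n + 2)"
        using cos_power_mean_pos[of n] by (simp add: cos_power_mean_Suc diff_divide_distrib)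
      also have "\<dots> = 1 / (2 * real n + 2)"
        by (simp add: field_simps)
      finally show ?thesis .
    qed
    ultimately show ?thesis
      using True by (simp add: integral_unique)
  next
    case False
    have "integral {0..1} (h i) = 1"
      by (rule integral_unique)
        (use has_integral_divide[OF has_integral_cos_power[of "x $ i" n], of "cos_power_mean n"]
          cos_power_mean_pos[of n] False in \<open>simp add: h_def[abs_def]\<close>)
    with False show ?thesis
      by simp
  qed
  have "(\<integral>y. (\<Prod>i\<in>UNIV. h i (y $ i)) \<partial>torus) = (\<Prod>i\<in>UNIV. integral {0..1} (h i))"
  proof (rule integral_torus_prod)
    show "continuous_on UNIV (h i)" for i
      unfolding h_def[abs_def] using cos_power_mean_pos[of n] by (cases "i = j") (auto intro!: continuous_intros)
    show "0 \<le> h i t" for i t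
      using cos_power_mean_pos[of n] by (simp add: h_def power_mult)
  qed
  moreover have "(\<Prod>i\<in>UNIV. h i (y $ i)) = vp_kernel n (x - y) * (sin (pi * (x $ j - y $ j)))\<^sup>2" for y
    by (simp only: h_def prod.distrib vp_kernel_def prod.delta finite vector_minus_component UNIV_I if_True)
  moreover have "(\<Prod>i\<in>UNIV. integral {0..1} (h i)) = 1 / (2 * real n + 2)"
    by (simp add: int)
  ultimately show ?thesis
    by simp
qed

section \<open>Convolution with the kernels\<close>

lemma id_measurable_torus: "(\<lambda>x. x) \<in> borel_measurable torus"
  by (simp add: torus_def measurable_restrict_space1)

lemma integrable_translation_kernel:
  fixes h :: "real ^ 'd::finite \<Rightarrow> real"
  assumes h: "continuous_on UNIV h" and v: "integrable torus v" and p: "integrable torus p"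
  shows "integrable (torus \<Otimes>\<^sub>M torus) (\<lambda>(x, y). v x * h (x - y) * p y)"
proof -
  note id_measurable_torus[measurable]
  have [measurable]: "h \<in> borel_measurable borel"
    using h by (rule borel_measurable_continuous_onI)
  have [measurable]: "v \<in> borel_measurable torus" "p \<in> borel_measurable torus"
    using v p by auto
  have vp: "integrable (torus \<Otimes>\<^sub>M torus) (\<lambda>(x, y). v x * p y)"
    by (rule torus_pair.Fubini_integrable) (use v p in \<open>auto simp: abs_mult\<close>)
  have "compact ((\<lambda>z. h (fst z - snd z)) ` (cbox 0 1 \<times> cbox 0 1))"
    by (intro compact_continuous_image compact_Times compact_cbox continuous_on_compose2[OF h] continuous_intros) auto
  then have "\<exists>C. \<forall>z\<in>cbox 0 1 \<times> cbox 0 1. norm (h (fst z - snd z)) \<le> C"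
    by (auto dest!: compact_imp_bounded simp: bounded_iff)
  then obtain C where C: "\<And>z. z \<in> cbox 0 1 \<times> cbox 0 1 \<Longrightarrow> norm (h (fst z - snd z)) \<le> C"
    by blast
  show ?thesis
  proof (rule Bochner_Integration.integrable_bound)
    show "integrable (torus \<Otimes>\<^sub>M torus) (\<lambda>(x, y). C * (v x * p y))"
      using integrable_mult_right[OF vp, of C] by (simp add: case_prod_unfold)
    show "AE z in torus \<Otimes>\<^sub>M torus. norm (case z of (x, y) \<Rightarrow> v x * h (x - y) * p y)
        \<le> norm (case z of (x, y) \<Rightarrow> C * (v x * p y))"
    proof (intro AE_I2, safe)
      fix x y :: "real ^ 'd"
      assume "(x, y) \<in> space (torus \<Otimes>\<^sub>M torus)"
      then have "\<bar>h (x - y)\<bar> \<le> C"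
        using C[of "(x, y)"] by (simp add: space_pair_measure space_torus)
      then have "\<bar>h (x - y)\<bar> * \<bar>v x * p y\<bar> \<le> \<bar>C\<bar> * \<bar>v x * p y\<bar>"
        by (intro mult_right_mono) auto
      then show "norm (v x * h (x - y) * p y) \<le> norm (C * (v x * p y))"
        by (simp add: abs_mult mult_ac)
    qed
  qed measurable
qed

text \<open>
  The double integral of \<open>v(x) h(x - y) p(y)\<close>: for periodic \<open>h\<close>, the inner product of \<open>v\<close> with the
  convolution of \<open>h\<close> and \<open>p\<close>.  Working with this form avoids any regularity of the convolution itself.
\<close>

definition conv_form :: "(real ^ 'd::finite \<Rightarrow> real) \<Rightarrow> (real ^ 'd \<Rightarrow> real) \<Rightarrow> (real ^ 'd \<Rightarrow> real) \<Rightarrow> real" where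
  "conv_form h v p = (\<integral>z. (case z of (x, y) \<Rightarrow> v x * h (x - y) * p y) \<partial>(torus \<Otimes>\<^sub>M torus))"

lemma conv_form_eq:
  assumes "continuous_on UNIV h" "integrable torus v" "integrable torus p"
  shows conv_form_fst: "conv_form h v p = (\<integral>x. v x * (\<integral>y. h (x - y) * p y \<partial>torus) \<partial>torus)"
    and conv_form_snd: "conv_form h v p = (\<integral>y. p y * (\<integral>x. h (x - y) * v x \<partial>torus) \<partial>torus)"
proof -
  note int = integrable_translation_kernel[OF assms]
  show "conv_form h v p = (\<integral>x. v x * (\<integral>y. h (x - y) * p y \<partial>torus) \<partial>torus)"
    unfolding conv_form_def torus_pair.integral_fst[OF int, symmetric]
    by (simp add: mult.assoc)
  show "conv_form h v p = (\<integral>y. p y * (\<integral>x. h (x - y) * v x \<partial>torus) \<partial>torus)"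
    unfolding conv_form_def torus_pair.integral_snd[OF int, symmetric]
    by (simp add: mult.assoc mult.commute[of "v _"] mult.left_commute[of "v _"] mult.commute[of _ "p _"])
qed

lemma conv_form_diff_right:
  assumes "continuous_on UNIV h" "integrable torus v" "integrable torus p" "integrable torus q"
  shows "conv_form h v (\<lambda>x. p x - q x) = conv_form h v p - conv_form h v q"
  unfolding conv_form_def
  by (subst Bochner_Integration.integral_diff[OF integrable_translation_kernel[OF assms(1,2,3)]
        integrable_translation_kernel[OF assms(1,2,4)], symmetric])
    (simp add: case_prod_unfold right_diff_distrib)

lemma abs_mult_le_weighted:
  fixes a b s :: real
  assumes "s > 0"
  shows "\<bar>a * b\<bar> \<le> (s * a\<^sup>2 + b\<^sup>2 / s) / 2"
proof -
  have "0 \<le> (sqrt s * \<bar>a\<bar> - \<bar>b\<bar> / sqrt s)\<^sup>2"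
    by simp
  also have "\<dots> = s * a\<^sup>2 + b\<^sup>2 / s - 2 * \<bar>a * b\<bar>"
    using assms by (simp add: power2_diff power_mult_distrib power_divide abs_mult)
  finally show ?thesis
    by simp
qed

text \<open>Uniform boundedness of the forms, with a weight \<open>s\<close> that is chosen later.\<close>

lemma abs_conv_form_vp_kernel_le:
  assumes v: "square_integrable v" and p: "square_integrable p" and s: "s > 0"
  shows "\<bar>conv_form (vp_kernel n) v p\<bar> \<le> (s * (\<integral>x. (v x)\<^sup>2 \<partial>torus) + (\<integral>x. (p x)\<^sup>2 \<partial>torus) / s) / 2"
proof -
  note k = continuous_on_vp_kernel[of n]
  have v2: "integrable torus (\<lambda>x. (v x)\<^sup>2)" and p2: "integrable torus (\<lambda>x. (p x)\<^sup>2)"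
    using v p by (auto simp: square_integrable_def)
  have one: "integrable torus (\<lambda>x :: real ^ 'a. 1 :: real)"
    by simp
  have int_v: "integrable (torus \<Otimes>\<^sub>M torus) (\<lambda>(x, y). (v x)\<^sup>2 * vp_kernel n (x - y) * 1)"
    and int_p: "integrable (torus \<Otimes>\<^sub>M torus) (\<lambda>(x, y). 1 * vp_kernel n (x - y) * (p y)\<^sup>2)"
    by (rule integrable_translation_kernel[OF k v2 one] integrable_translation_kernel[OF k one p2])+
  have "\<bar>conv_form (vp_kernel n) v p\<bar> \<le>
      (\<integral>z. \<bar>case z of (x, y) \<Rightarrow> v x * vp_kernel n (x - y) * p y\<bar> \<partial>(torus \<Otimes>\<^sub>M torus))"
    unfolding conv_form_def by (rule integral_abs_bound)
  also have "\<dots> \<le> (\<integral>z. s / 2 * (case z of (x, y) \<Rightarrow> (v x)\<^sup>2 * vp_kernel n (x - y) * 1)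
      + 1 / (2 * s) * (case z of (x, y) \<Rightarrow> 1 * vp_kernel n (x - y) * (p y)\<^sup>2) \<partial>(torus \<Otimes>\<^sub>M torus))"
  proof (intro integral_mono)
    show "integrable (torus \<Otimes>\<^sub>M torus) (\<lambda>z. \<bar>case z of (x, y) \<Rightarrow> v x * vp_kernel n (x - y) * p y\<bar>)"
      using integrable_translation_kernel[OF k square_integrable_integrable[OF v] square_integrable_integrable[OF p]]
      by (rule integrable_abs)
    show "integrable (torus \<Otimes>\<^sub>M torus) (\<lambda>z. s / 2 * (case z of (x, y) \<Rightarrow> (v x)\<^sup>2 * vp_kernel n (x - y) * 1)
      + 1 / (2 * s) * (case z of (x, y) \<Rightarrow> 1 * vp_kernel n (x - y) * (p y)\<^sup>2))"
      by (intro Bochner_Integration.integrable_add integrable_mult_right int_v int_p)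
    show "\<bar>case z of (x, y) \<Rightarrow> v x * vp_kernel n (x - y) * p y\<bar> \<le>
        s / 2 * (case z of (x, y) \<Rightarrow> (v x)\<^sup>2 * vp_kernel n (x - y) * 1)
      + 1 / (2 * s) * (case z of (x, y) \<Rightarrow> 1 * vp_kernel n (x - y) * (p y)\<^sup>2)" for z
    proof -
      obtain x y where z: "z = (x, y)"
        by (cases z)
      have "vp_kernel n (x - y) * \<bar>v x * p y\<bar> \<le>
          vp_kernel n (x - y) * ((s * (v x)\<^sup>2 + (p y)\<^sup>2 / s) / 2)"
        by (intro mult_left_mono abs_mult_le_weighted s vp_kernel_nonneg)
      then show ?thesis
        using vp_kernel_nonneg[of n "x - y"] s by (simp add: z abs_mult field_simps)
    qed
  qed
  also have "\<dots> = s / 2 * conv_form (vp_kernel n) (\<lambda>x. (v x)\<^sup>2) (\<lambda>x. 1)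
      + 1 / (2 * s) * conv_form (vp_kernel n) (\<lambda>x. 1) (\<lambda>x. (p x)\<^sup>2)"
    unfolding conv_form_def
    by (simp only: Bochner_Integration.integral_add integrable_mult_right int_v int_p integral_mult_right_zero)
  also have "conv_form (vp_kernel n) (\<lambda>x. (v x)\<^sup>2) (\<lambda>x. 1) = (\<integral>x. (v x)\<^sup>2 \<partial>torus)"
    by (simp add: conv_form_fst[OF k v2 one] integral_vp_kernel)
  also have "conv_form (vp_kernel n) (\<lambda>x. 1) (\<lambda>x. (p x)\<^sup>2) = (\<integral>x. (p x)\<^sup>2 \<partial>torus)"
    by (simp add: conv_form_snd[OF k one p2]) (simp add: vp_kernel_minus_commute[of n _ "_ :: real ^ 'a"] integral_vp_kernel)
  finally show ?thesis
    by (simp add: field_simps)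
qed

text \<open>
  Korovkin's argument: the oscillation of \<open>q\<close> is controlled by the trigonometric distance
  \<open>\<Sum>i. sin\<^sup>2 (\<pi> (x\<^sub>i - y\<^sub>i))\<close>, whose mean under the kernel tends to zero.
\<close>

lemma oscillation_le_sin:
  fixes q :: "real ^ 'd::finite \<Rightarrow> real"
  assumes q: "continuous_on (cbox 0 1) q"
    and per: "\<And>x y. x \<in> cbox 0 1 \<Longrightarrow> y \<in> cbox 0 1 \<Longrightarrow> (\<And>i. sin (pi * (x $ i - y $ i)) = 0) \<Longrightarrow> q x = q y"
    and e: "e > 0"
  shows "\<exists>C\<ge>0. \<forall>x\<in>cbox 0 1. \<forall>y\<in>cbox 0 1.
      \<bar>q y - q x\<bar> \<le> e + C * (\<Sum>i\<in>UNIV. (sin (pi * (x $ i - y $ i)))\<^sup>2)"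
proof -
  let ?Q = "cbox 0 1 \<times> cbox 0 1 :: ((real ^ 'd) \<times> (real ^ 'd)) set"
  define d where "d z = \<bar>q (snd z) - q (fst z)\<bar>" for z
  define S where "S z = (\<Sum>i\<in>UNIV. (sin (pi * (fst z $ i - snd z $ i)))\<^sup>2)" for z :: "(real ^ 'd) \<times> (real ^ 'd)"
  have S_nonneg: "S z \<ge> 0" for z
    by (simp add: S_def sum_nonneg)
  have cd: "continuous_on ?Q d"
    unfolding d_def
    by (intro continuous_intros continuous_on_compose2[OF q]) auto
  have cS: "continuous_on A S" for A
    unfolding S_def by (intro continuous_intros)
  have "compact (d ` ?Q)"
    by (intro compact_continuous_image cd compact_Times compact_cbox)
  then have "\<exists>M>0. \<forall>z\<in>?Q. norm (d z) \<le> M"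
    using compact_imp_bounded[of "d ` ?Q"] unfolding bounded_pos by simp
  then obtain M where M: "\<And>z. z \<in> ?Q \<Longrightarrow> d z \<le> M" and "M \<ge> 0"
    by (metis abs_le_D1 less_imp_le real_norm_def)
  define A where "A = {z \<in> ?Q. e \<le> d z}"
  have "closed A"
  proof -
    have "closed (?Q \<inter> d -` {e..})"
      by (intro continuous_closed_preimage cd closed_Times closed_cbox closed_atLeast)
    also have "?Q \<inter> d -` {e..} = A"
      by (auto simp: A_def)
    finally show ?thesis .
  qed
  then have "compact A"
    using compact_Int_closed[OF compact_Times[OF compact_cbox compact_cbox], of A 0 1 0 1]
    by (simp add: A_def Int_absorb1 subset_iff)
  show ?thesis
  proof (cases "A = {}")
    case True
    then show ?thesis
      by (intro exI[of _ 0]) (force simp: A_def d_def)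
  next
    case False
    then obtain z0 where z0: "z0 \<in> A" "\<And>z. z \<in> A \<Longrightarrow> S z0 \<le> S z"
      using continuous_attains_inf[OF \<open>compact A\<close> _ cS] by blast
    have "S z0 \<noteq> 0"
    proof
      assume "S z0 = 0"
      then have "sin (pi * (fst z0 $ i - snd z0 $ i)) = 0" for i
        unfolding S_def by (subst (asm) sum_nonneg_eq_0_iff) auto
      then have "q (fst z0) = q (snd z0)"
        using z0(1) by (intro per) (auto simp: A_def)
      then show False
        using z0(1) e by (simp add: A_def d_def)
    qed
    then have S0: "S z0 > 0"
      using S_nonneg[of z0] by simp
    have "d z \<le> e + M / S z0 * S z" if "z \<in> ?Q" for z
    proof (cases "z \<in> A")
      case True
      then have "M * 1 \<le> M * (S z / S z0)"
        using z0(2)[OF True] S0 \<open>M \<ge> 0\<close> by (intro mult_left_mono) auto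
      with M[OF that] e show ?thesis
        by simp
    next
      case False
      then have "d z \<le> e"
        using that by (simp add: A_def)
      moreover have "0 \<le> M / S z0 * S z"
        using S0 \<open>M \<ge> 0\<close> S_nonneg[of z] by simp
      ultimately show ?thesis
        by simp
    qed
    then show ?thesis
      using S0 \<open>M \<ge> 0\<close> by (intro exI[of _ "M / S z0"]) (force simp: d_def S_def)
  qed
qed

lemma square_integrable_continuous:
  assumes "continuous_on UNIV q"
  shows "square_integrable q"
proof -
  have "q \<in> borel_measurable torus"
    unfolding torus_def by (intro measurable_restrict_space1) (use borel_measurable_continuous_onI[OF assms] in simp)
  moreover have "compact (q ` cbox 0 1)"
    by (intro compact_continuous_image continuous_on_subset[OF assms]) auto
  then have "\<exists>C. \<forall>x\<in>cbox 0 1. norm (q x) \<le> C"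
    by (auto dest!: compact_imp_bounded simp: bounded_iff)
  then obtain C where "\<And>x. x \<in> cbox 0 1 \<Longrightarrow> norm (q x) \<le> C"
    by blast
  ultimately show ?thesis
    using square_integrable_bound[OF square_integrable_scale[OF square_integrable_1, of C], of q]
    by (force simp: space_torus)
qed

lemma vp_kernel_convolution_uniform:
  fixes q :: "real ^ 'd::finite \<Rightarrow> real"
  assumes q: "continuous_on UNIV q"
    and per: "\<And>x y. x \<in> cbox 0 1 \<Longrightarrow> y \<in> cbox 0 1 \<Longrightarrow> (\<And>i. sin (pi * (x $ i - y $ i)) = 0) \<Longrightarrow> q x = q y"
    and e: "e > 0"
  shows "\<forall>\<^sub>F n in sequentially. \<forall>x\<in>cbox 0 1. \<bar>(\<integral>y. vp_kernel n (x - y) * q y \<partial>torus) - q x\<bar> \<le> e"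
proof -
  have "e / 2 > 0"
    using e by simp
  obtain C where C: "C \<ge> 0" "\<And>x y. x \<in> cbox 0 1 \<Longrightarrow> y \<in> cbox 0 1 \<Longrightarrow>
      \<bar>q y - q x\<bar> \<le> e / 2 + C * (\<Sum>i\<in>UNIV. (sin (pi * (x $ i - y $ i)))\<^sup>2)"
    using oscillation_le_sin[OF continuous_on_subset[OF q subset_UNIV] per \<open>e / 2 > 0\<close>] by blast
  have "(\<lambda>n. C * real CARD('d) / (2 * real n + 2)) \<longlonglongrightarrow> 0"
    by real_asymp
  then have "\<forall>\<^sub>F n in sequentially. C * real CARD('d) / (2 * real n + 2) < e / 2"
    using e by (intro order_tendstoD(2)) auto
  then show ?thesis
  proof eventually_elim
    case (elim n)
    show ?case
    proof
      fix x :: "real ^ 'd" assume x: "x \<in> cbox 0 1"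
      let ?k = "\<lambda>y. vp_kernel n (x - y)"
      have ck: "continuous_on UNIV ?k"
        by (rule continuous_on_compose2[OF continuous_on_vp_kernel]) (auto intro!: continuous_intros)
      have int: "integrable torus (\<lambda>y. ?k y * r y)" if "continuous_on UNIV r" for r
        using ck that by (intro square_integrable_mult square_integrable_continuous)
      have int_s: "integrable torus (\<lambda>y. ?k y * (sin (pi * (x $ i - y $ i)))\<^sup>2)" for i
        by (intro int continuous_intros)
      have int_k: "integrable torus ?k"
        using int[of "\<lambda>_. 1"] by simp
      have "(\<integral>y. ?k y * q y \<partial>torus) - q x = (\<integral>y. ?k y * q y \<partial>torus) - q x * (\<integral>y. ?k y \<partial>torus)"
        by (simp add: integral_vp_kernel)
      also have "\<dots> = (\<integral>y. ?k y * (q y - q x) \<partial>torus)"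
        by (simp add: right_diff_distrib int q int_k mult.commute[of _ "q x"])
      also have "\<bar>\<dots>\<bar> \<le> (\<integral>y. \<bar>?k y * (q y - q x)\<bar> \<partial>torus)"
        by (rule integral_abs_bound)
      also have "\<dots> \<le> (\<integral>y. e / 2 * ?k y + C * (\<Sum>i\<in>UNIV. ?k y * (sin (pi * (x $ i - y $ i)))\<^sup>2) \<partial>torus)"
      proof (intro integral_mono integrable_abs)
        show "integrable torus (\<lambda>y. ?k y * (q y - q x))"
          by (intro int continuous_intros q)
        show "integrable torus (\<lambda>y. e / 2 * ?k y + C * (\<Sum>i\<in>UNIV. ?k y * (sin (pi * (x $ i - y $ i)))\<^sup>2))"
          by (intro Bochner_Integration.integrable_add integrable_mult_right Bochner_Integration.integrable_sum int_k int_s)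
        fix y :: "real ^ 'd" assume "y \<in> space torus"
        then have "?k y * \<bar>q y - q x\<bar> \<le> ?k y * (e / 2 + C * (\<Sum>i\<in>UNIV. (sin (pi * (x $ i - y $ i)))\<^sup>2))"
          using C(2)[OF x, of y] by (intro mult_left_mono vp_kernel_nonneg) (simp add: space_torus)
        then show "\<bar>?k y * (q y - q x)\<bar> \<le>
            e / 2 * ?k y + C * (\<Sum>i\<in>UNIV. ?k y * (sin (pi * (x $ i - y $ i)))\<^sup>2)"
          using vp_kernel_nonneg[of n "x - y"]
          by (simp add: abs_mult distrib_left sum_distrib_left[symmetric] mult_ac)
      qed
      also have "\<dots> = e / 2 + C * real CARD('d) / (2 * real n + 2)"
        by (subst Bochner_Integration.integral_add)
          (auto intro!: integrable_mult_right Bochner_Integration.integrable_sum int_k int_s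
            simp: Bochner_Integration.integral_sum int_s integral_vp_kernel integral_vp_kernel_sin)
      also have "\<dots> \<le> e"
        using elim by linarith
      finally show "\<bar>(\<integral>y. ?k y * q y \<partial>torus) - q x\<bar> \<le> e" .
    qed
  qed
qed

section \<open>Weak convergence of the convolutions\<close>

text \<open>
  Every borel function on the cube is an almost everywhere limit of continuous functions.  Truncating
  these and cutting them off near the boundary of the cube makes them periodic and bounded.
\<close>

lemma periodic_continuous_AE_approx:
  fixes p :: "real ^ 'd::finite \<Rightarrow> real"
  assumes p: "p \<in> borel_measurable torus" and M: "\<And>x. \<bar>p x\<bar> \<le> M"
  obtains q where "\<And>k. continuous_on UNIV (q k)" "\<And>k x. x \<in> cbox 0 1 \<Longrightarrow> \<bar>q k x\<bar> \<le> M"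
    "\<And>k x. x \<in> cbox 0 1 - box 0 1 \<Longrightarrow> q k x = 0"
    "AE x in torus. (\<lambda>k. q k x) \<longlonglongrightarrow> p x"
proof -
  let ?p = "\<lambda>x. indicator (cbox 0 1) x *\<^sub>R p x"
  have "?p \<in> borel_measurable lborel"
    using p unfolding torus_def by (subst (asm) borel_measurable_restrict_space_iff) auto
  then have "?p \<in> borel_measurable lebesgue"
    by (rule measurable_completion)
  then have "?p measurable_on UNIV"
    by (rule lebesgue_measurable_imp_measurable_on) auto
  then obtain N g where N: "negligible N" and g: "\<And>k. continuous_on UNIV (g k)"
    and lim: "\<And>x. x \<notin> N \<Longrightarrow> (\<lambda>k. g k x) \<longlonglongrightarrow> ?p x"
    unfolding measurable_on_def by auto
  have "M \<ge> 0"
    using M[of undefined] by linarith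
  \<comment> \<open>\<open>c\<close> vanishes exactly on the boundary of the cube, so the factor \<open>min 1 (k c)\<close> tends to 1 inside it.\<close>
  define c :: "real ^ 'd \<Rightarrow> real" where "c x = (\<Prod>i\<in>UNIV. x $ i * (1 - x $ i))" for x
  define q where "q k x = min 1 (real k * c x) * max (- M) (min M (g k x))" for k x
  have c_nonneg: "c x \<ge> 0" if "x \<in> cbox 0 1" for x
    using that by (auto simp: c_def mem_box_cart intro!: prod_nonneg)
  show thesis
  proof (rule that)
    show "continuous_on UNIV (q k)" for k
      unfolding q_def[abs_def] c_def by (intro continuous_intros g)
    show "\<bar>q k x\<bar> \<le> M" if "x \<in> cbox 0 1" for k x
    proof -
      have "\<bar>min 1 (real k * c x)\<bar> * \<bar>max (- M) (min M (g k x))\<bar> \<le> 1 * M"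
        using c_nonneg[OF that] \<open>M \<ge> 0\<close> by (intro mult_mono) auto
      then show ?thesis
        by (simp add: q_def abs_mult)
    qed
    show "q k x = 0" if x: "x \<in> cbox 0 1 - box 0 1" for k x
    proof -
      obtain i where "\<not> (0 < x $ i \<and> x $ i < 1)"
        using x by (auto simp: mem_box_cart)
      moreover have "0 \<le> x $ i" "x $ i \<le> 1"
        using x by (auto simp: mem_box_cart)
      ultimately have "x $ i = 0 \<or> x $ i = 1"
        by linarith
      then have "c x = 0"
        unfolding c_def by (intro prod_zero) auto
      then show ?thesis
        by (simp add: q_def)
    qed
    have "negligible (N \<union> (cbox 0 1 - box 0 1))"
      using N negligible_frontier_interval by (intro negligible_Un) auto
    then have "AE x in lebesgue. x \<notin> N \<union> (cbox 0 1 - box 0 1)"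
      by (intro AE_not_in) (simp add: negligible_iff_null_sets)
    then have "AE x in lborel. x \<notin> N \<union> (cbox 0 1 - box 0 1)"
      by (simp add: AE_completion_iff)
    then have "AE x in torus. x \<notin> N \<union> (cbox 0 1 - box 0 1)"
      unfolding torus_def by (subst AE_restrict_space_iff) (auto elim: eventually_mono)
    then show "AE x in torus. (\<lambda>k. q k x) \<longlonglongrightarrow> p x"
      using AE_space
    proof eventually_elim
      case (elim x)
      then have x: "x \<in> cbox 0 1" "x \<in> box 0 1" "x \<notin> N"
        by (auto simp: space_torus)
      have "(\<lambda>k. max (- M) (min M (g k x))) \<longlonglongrightarrow> max (- M) (min M (?p x))"
        by (intro tendsto_intros lim x)
      also have "max (- M) (min M (?p x)) = p x"
        using x M[of x] by (simp add: abs_le_iff)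
      finally have *: "(\<lambda>k. max (- M) (min M (g k x))) \<longlonglongrightarrow> p x" .
      have "c x > 0"
        using x(2) by (auto simp: c_def mem_box_cart intro!: prod_pos)
      then have "filterlim (\<lambda>k. real k * c x) at_top sequentially"
        by real_asymp
      then have "\<forall>\<^sub>F k in sequentially. 1 \<le> real k * c x"
        by (simp add: filterlim_at_top)
      then have "\<forall>\<^sub>F k in sequentially. max (- M) (min M (g k x)) = q k x"
        by eventually_elim (simp add: q_def)
      with * show ?case
        by (rule Lim_transform_eventually)
    qed
  qed
qed

lemma integral_square_diff_tendsto_0:
  fixes p :: "real ^ 'd::finite \<Rightarrow> real"
  assumes [measurable]: "p \<in> borel_measurable torus" "\<And>k. q k \<in> borel_measurable torus"
    and w: "integrable torus w" and bound: "\<And>k x. x \<in> cbox 0 1 \<Longrightarrow> (p x - q k x)\<^sup>2 \<le> w x"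
    and lim: "AE x in torus. (\<lambda>k. q k x) \<longlonglongrightarrow> p x"
  shows "(\<lambda>k. \<integral>x. (p x - q k x)\<^sup>2 \<partial>torus) \<longlonglongrightarrow> 0"
proof -
  have "(\<lambda>k. \<integral>x. (p x - q k x)\<^sup>2 \<partial>torus) \<longlonglongrightarrow> (\<integral>x. 0 \<partial>(torus :: (real ^ 'd) measure))"
  proof (rule integral_dominated_convergence)
    show "AE x in torus. (\<lambda>k. (p x - q k x)\<^sup>2) \<longlonglongrightarrow> 0"
      using lim
    proof eventually_elim
      case (elim x)
      then have "(\<lambda>k. (p x - q k x)\<^sup>2) \<longlonglongrightarrow> (p x - p x)\<^sup>2"
        by (intro tendsto_intros)
      then show ?case
        by simp
    qed
    show "AE x in torus. norm ((p x - q k x)\<^sup>2) \<le> w x" for k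
      using bound by (intro AE_I2) (simp add: space_torus)
  qed (use w in measurable)
  then show ?thesis
    by simp
qed

lemma square_integrable_periodic_approx:
  fixes p :: "real ^ 'd::finite \<Rightarrow> real"
  assumes p: "square_integrable p" and e: "e > 0"
  shows "\<exists>q. continuous_on UNIV q \<and> (\<forall>x \<in> cbox 0 1 - box 0 1. q x = 0) \<and>
    (\<integral>x. (p x - q x)\<^sup>2 \<partial>torus) < e"
proof -
  have [measurable]: "p \<in> borel_measurable torus" and p2: "integrable torus (\<lambda>x. (p x)\<^sup>2)"
    using p by (auto simp: square_integrable_def)
  define t where "t M x = max (- real M) (min (real M) (p x))" for M :: nat and x
  have [measurable]: "t M \<in> borel_measurable torus" for M
    unfolding t_def[abs_def] by measurable
  have "(\<lambda>M. \<integral>x. (p x - t M x)\<^sup>2 \<partial>torus) \<longlonglongrightarrow> 0"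
  proof (rule integral_square_diff_tendsto_0[OF _ _ p2])
    show "(p x - t M x)\<^sup>2 \<le> (p x)\<^sup>2" for M x
      unfolding abs_le_square_iff[symmetric] by (simp add: t_def)
    show "AE x in torus. (\<lambda>M. t M x) \<longlonglongrightarrow> p x"
    proof (rule AE_I2)
      fix x :: "real ^ 'd"
      have "\<forall>\<^sub>F M in sequentially. t M x = p x"
        using eventually_ge_at_top[of "nat \<lceil>\<bar>p x\<bar>\<rceil>"]
      proof eventually_elim
        case (elim M)
        then have "\<bar>p x\<bar> \<le> real M"
          by linarith
        then show ?case
          by (simp add: t_def abs_le_iff)
      qed
      then show "(\<lambda>M. t M x) \<longlonglongrightarrow> p x"
        by (rule tendsto_eventually)
    qed
  qed measurable
  then obtain M where M: "(\<integral>x. (p x - t M x)\<^sup>2 \<partial>torus) < e / 4"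
    using order_tendstoD(2)[of _ 0 sequentially "e / 4"] e eventually_happens'[OF sequentially_bot] by fastforce
  have t_le: "\<bar>t M x\<bar> \<le> real M" for x
    by (simp add: t_def abs_le_iff)
  have sq_t: "square_integrable (t M)"
    by (rule square_integrable_bound[OF square_integrable_scale[OF square_integrable_1, of "real M"]])
      (use t_le in auto)
  obtain q where q: "\<And>k. continuous_on UNIV (q k)" "\<And>k x. x \<in> cbox 0 1 \<Longrightarrow> \<bar>q k x\<bar> \<le> real M"
    "\<And>k x. x \<in> cbox 0 1 - box 0 1 \<Longrightarrow> q k x = 0" "AE x in torus. (\<lambda>k. q k x) \<longlonglongrightarrow> t M x"
    using periodic_continuous_AE_approx[of "t M" "real M"] t_le by auto
  have sq_q: "square_integrable (q k)" for k
    by (rule square_integrable_continuous[OF q(1)])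
  then have [measurable]: "q k \<in> borel_measurable torus" for k
    by (simp add: square_integrable_def)
  have "(\<lambda>k. \<integral>x. (t M x - q k x)\<^sup>2 \<partial>torus) \<longlonglongrightarrow> 0"
  proof (rule integral_square_diff_tendsto_0[OF _ _ _ _ q(4)])
    show "integrable torus (\<lambda>x :: real ^ 'd. (2 * real M)\<^sup>2)"
      by simp
    show "(t M x - q k x)\<^sup>2 \<le> (2 * real M)\<^sup>2" if "x \<in> cbox 0 1" for k x
      unfolding abs_le_square_iff[symmetric] using t_le[of x] q(2)[OF that, of k] by simp
  qed measurable
  then obtain k where k: "(\<integral>x. (t M x - q k x)\<^sup>2 \<partial>torus) < e / 4"
    using order_tendstoD(2)[of _ 0 sequentially "e / 4"] e eventually_happens'[OF sequentially_bot] by fastforce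
  have int1: "integrable torus (\<lambda>x. (p x - t M x)\<^sup>2)" and int2: "integrable torus (\<lambda>x. (t M x - q k x)\<^sup>2)"
    using square_integrable_diff[OF p sq_t] square_integrable_diff[OF sq_t sq_q[of k]]
    by (auto simp: square_integrable_def)
  have "(\<integral>x. (p x - q k x)\<^sup>2 \<partial>torus) \<le> (\<integral>x. 2 * (p x - t M x)\<^sup>2 + 2 * (t M x - q k x)\<^sup>2 \<partial>torus)"
  proof (rule integral_mono)
    show "integrable torus (\<lambda>x. (p x - q k x)\<^sup>2)"
      using square_integrable_diff[OF p sq_q[of k]] by (simp add: square_integrable_def)
    show "integrable torus (\<lambda>x. 2 * (p x - t M x)\<^sup>2 + 2 * (t M x - q k x)\<^sup>2)"
      using int1 int2 by auto
    show "(p x - q k x)\<^sup>2 \<le> 2 * (p x - t M x)\<^sup>2 + 2 * (t M x - q k x)\<^sup>2" for x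
      using sum_squares_bound[of "p x - t M x" "t M x - q k x"]
        power2_sum[of "p x - t M x" "t M x - q k x"] by simp
  qed
  also have "\<dots> = 2 * (\<integral>x. (p x - t M x)\<^sup>2 \<partial>torus) + 2 * (\<integral>x. (t M x - q k x)\<^sup>2 \<partial>torus)"
    using int1 int2 by simp
  also have "\<dots> < e"
    using M k by simp
  finally show ?thesis
    using q(1,3) by (intro exI[of _ "q k"]) auto
qed

lemma conv_form_tendsto_continuous:
  fixes v q :: "real ^ 'd::finite \<Rightarrow> real"
  assumes v: "integrable torus v" and q: "continuous_on UNIV q"
    and bd: "\<And>x. x \<in> cbox 0 1 - box 0 1 \<Longrightarrow> q x = 0"
  shows "(\<lambda>n. conv_form (vp_kernel n) v q) \<longlonglongrightarrow> (\<integral>x. v x * q x \<partial>torus)"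
proof (rule tendstoI)
  fix e :: real assume e: "e > 0"
  \<comment> \<open>Two different points of the cube that are congruent modulo the lattice both lie on its boundary.\<close>
  have per: "q x = q y" if x: "x \<in> cbox 0 1" and y: "y \<in> cbox 0 1"
    and s: "\<And>i. sin (pi * (x $ i - y $ i)) = 0" for x y
  proof (cases "x = y")
    case False
    then obtain i where i: "x $ i \<noteq> y $ i"
      by (auto simp: vec_eq_iff)
    obtain k :: int where "pi * (x $ i - y $ i) = of_int k * pi"
      using s[of i] by (auto simp: sin_zero_iff_int2)
    then have k: "x $ i - y $ i = of_int k"
      by simp
    have range: "0 \<le> x $ i" "x $ i \<le> 1" "0 \<le> y $ i" "y $ i \<le> 1"
      using x y by (auto simp: mem_box_cart)
    then have "real_of_int k \<le> 1" "- 1 \<le> real_of_int k" "k \<noteq> 0"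
      using k i by auto
    then have "k = 1 \<or> k = - 1"
      by linarith
    then have "\<not> (0 < x $ i \<and> x $ i < 1)" "\<not> (0 < y $ i \<and> y $ i < 1)"
      using k range by auto
    then have "x \<notin> box 0 1" "y \<notin> box 0 1"
      by (auto simp: mem_box_cart)
    then show ?thesis
      using bd x y by simp
  qed simp
  have qi: "integrable torus q"
    using square_integrable_integrable[OF square_integrable_continuous[OF q]] .
  define c where "c = (\<integral>x. \<bar>v x\<bar> \<partial>torus) + 1"
  have c: "c > 0"
    unfolding c_def by (intro add_nonneg_pos integral_nonneg_AE) auto
  have "\<forall>\<^sub>F n in sequentially. \<forall>x\<in>cbox 0 1. \<bar>(\<integral>y. vp_kernel n (x - y) * q y \<partial>torus) - q x\<bar> \<le> e / c / 2"
    using e c by (intro vp_kernel_convolution_uniform[OF q per]) auto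
  then show "\<forall>\<^sub>F n in sequentially. dist (conv_form (vp_kernel n) v q) (\<integral>x. v x * q x \<partial>torus) < e"
  proof eventually_elim
    case (elim n)
    let ?Tq = "\<lambda>x. \<integral>y. vp_kernel n (x - y) * q y \<partial>torus"
    have "integrable (torus \<Otimes>\<^sub>M torus) (\<lambda>(x, y). v x * vp_kernel n (x - y) * q y)"
      by (rule integrable_translation_kernel[OF continuous_on_vp_kernel v qi])
    from torus_pair.integrable_fst[OF this] have i1: "integrable torus (\<lambda>x. v x * ?Tq x)"
      by (simp add: mult.assoc)
    obtain B where B: "\<And>x. x \<in> cbox 0 1 \<Longrightarrow> \<bar>q x\<bar> \<le> B"
    proof -
      have "compact (q ` cbox 0 1)"
        by (intro compact_continuous_image continuous_on_subset[OF q]) auto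
      then have "\<exists>C. \<forall>x\<in>cbox 0 1. norm (q x) \<le> C"
        by (auto dest!: compact_imp_bounded simp: bounded_iff)
      with that show thesis
        by auto
    qed
    have i2: "integrable torus (\<lambda>x. v x * q x)"
    proof (rule Bochner_Integration.integrable_bound)
      show "integrable torus (\<lambda>x. B * v x)"
        using v by simp
      show "(\<lambda>x. v x * q x) \<in> borel_measurable torus"
        using v qi by (intro borel_measurable_times) auto
      show "AE x in torus. norm (v x * q x) \<le> norm (B * v x)"
      proof (rule AE_I2)
        fix x :: "real ^ 'd" assume "x \<in> space torus"
        then have "\<bar>q x\<bar> \<le> \<bar>B\<bar>"
          using B[of x] by (simp add: space_torus)
        then have "\<bar>q x\<bar> * \<bar>v x\<bar> \<le> \<bar>B\<bar> * \<bar>v x\<bar>"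
          by (rule mult_right_mono) simp
        then show "norm (v x * q x) \<le> norm (B * v x)"
          by (simp add: abs_mult mult.commute)
      qed
    qed
    have "conv_form (vp_kernel n) v q - (\<integral>x. v x * q x \<partial>torus) = (\<integral>x. v x * ?Tq x - v x * q x \<partial>torus)"
      by (simp add: conv_form_fst[OF continuous_on_vp_kernel v qi] i1 i2)
    also have "\<bar>\<dots>\<bar> \<le> (\<integral>x. \<bar>v x * ?Tq x - v x * q x\<bar> \<partial>torus)"
      by (rule integral_abs_bound)
    also have "\<dots> \<le> (\<integral>x. e / c / 2 * \<bar>v x\<bar> \<partial>torus)"
    proof (intro integral_mono integrable_abs Bochner_Integration.integrable_diff i1 i2)
      show "integrable torus (\<lambda>x. e / c / 2 * \<bar>v x\<bar>)"
        using v by auto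
      fix x :: "real ^ 'd" assume "x \<in> space torus"
      then have "\<bar>?Tq x - q x\<bar> * \<bar>v x\<bar> \<le> e / c / 2 * \<bar>v x\<bar>"
        using elim by (intro mult_right_mono) (auto simp: space_torus)
      then show "\<bar>v x * ?Tq x - v x * q x\<bar> \<le> e / c / 2 * \<bar>v x\<bar>"
        by (simp only: abs_mult[symmetric] left_diff_distrib mult.commute[of "v x"])
    qed
    also have "\<dots> = e / c / 2 * (c - 1)"
      by (simp add: c_def)
    also have "\<dots> < e"
    proof -
      have "e / c / 2 * (c - 1) = (e - e / c) / 2"
        using c by (simp add: field_simps)
      moreover have "(e - t) / 2 < e" if "t > 0" for t
        using e that by simp
      from this[OF divide_pos_pos[OF e c]] have "(e - e / c) / 2 < e" .
      ultimately show ?thesis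
        by (simp only:)
    qed
    finally show ?case
      by (simp add: dist_real_def)
  qed
qed

text \<open>
  The kernels form an approximate identity in the weak sense: the convergence for continuous functions
  and the uniform bound on the forms give it on all of \<open>L\<^sup>2\<close> by density.
\<close>

proposition conv_form_vp_kernel_tendsto:
  fixes v p :: "real ^ 'd::finite \<Rightarrow> real"
  assumes v: "square_integrable v" and p: "square_integrable p"
  shows "(\<lambda>n. conv_form (vp_kernel n) v p) \<longlonglongrightarrow> (\<integral>x. v x * p x \<partial>torus)"
proof (rule tendstoI)
  fix e :: real assume e: "e > 0"
  define V where "V = (\<integral>x. (v x)\<^sup>2 \<partial>torus)"
  have V: "V \<ge> 0"
    unfolding V_def by (intro integral_nonneg_AE) auto
  \<comment> \<open>The weight makes \<open>s V \<le> e/3\<close>; an \<open>L\<^sup>2\<close> error with square at most \<open>(e/3) s\<close> then costs at most \<open>e/3\<close>.\<close>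
  define s where "s = e / 3 / (V + 1)"
  have s: "s > 0"
    using e V by (simp add: s_def)
  have sV: "s * V \<le> e / 3"
  proof -
    have "s * V \<le> s * (V + 1)"
      using s by (intro mult_left_mono) auto
    also have "s * (V + 1) = e / 3"
    proof -
      have "V + 1 \<noteq> 0"
        using V by simp
      then show ?thesis
        unfolding s_def by (subst times_divide_eq_left, subst nonzero_divide_eq_eq) auto
    qed
    finally show ?thesis .
  qed
  obtain q where q: "continuous_on UNIV q" "\<And>x. x \<in> cbox 0 1 - box 0 1 \<Longrightarrow> q x = 0"
    and pq: "(\<integral>x. (p x - q x)\<^sup>2 \<partial>torus) < e / 3 * s"
    using square_integrable_periodic_approx[OF p, of "e / 3 * s"] e s by auto
  have sq_q: "square_integrable q"
    by (rule square_integrable_continuous[OF q(1)])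
  have sq_pq: "square_integrable (\<lambda>x. p x - q x)"
    using p sq_q by (rule square_integrable_diff)
  have small: "(s * (\<integral>x. (v x)\<^sup>2 \<partial>torus) + (\<integral>x. (p x - q x)\<^sup>2 \<partial>torus) / s) / 2 \<le> e / 3"
  proof -
    have "(\<integral>x. (p x - q x)\<^sup>2 \<partial>torus) / s \<le> e / 3"
      using pq s by (simp add: divide_le_eq)
    then show ?thesis
      using sV by (simp add: V_def)
  qed
  have B: "\<bar>conv_form (vp_kernel n) v p - conv_form (vp_kernel n) v q\<bar> \<le> e / 3" for n
    using order_trans[OF abs_conv_form_vp_kernel_le[OF v sq_pq s] small]
    by (simp add: conv_form_diff_right continuous_on_vp_kernel v p sq_q square_integrable_integrable)
  have I: "\<bar>(\<integral>x. v x * p x \<partial>torus) - (\<integral>x. v x * q x \<partial>torus)\<bar> \<le> e / 3"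
  proof -
    have v2: "integrable torus (\<lambda>x. (v x)\<^sup>2)" and pq2: "integrable torus (\<lambda>x. (p x - q x)\<^sup>2)"
      using v sq_pq by (auto simp: square_integrable_def)
    have "(\<integral>x. v x * p x \<partial>torus) - (\<integral>x. v x * q x \<partial>torus) = (\<integral>x. v x * (p x - q x) \<partial>torus)"
      using square_integrable_mult[OF v p] square_integrable_mult[OF v sq_q] by (simp add: right_diff_distrib)
    also have "\<bar>\<dots>\<bar> \<le> (\<integral>x. \<bar>v x * (p x - q x)\<bar> \<partial>torus)"
      by (rule integral_abs_bound)
    also have "\<dots> \<le> (\<integral>x. (s * (v x)\<^sup>2 + (p x - q x)\<^sup>2 / s) / 2 \<partial>torus)"
      using v2 pq2 by (intro integral_mono integrable_abs square_integrable_mult v sq_pq abs_mult_le_weighted s) auto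
    also have "\<dots> = (s * (\<integral>x. (v x)\<^sup>2 \<partial>torus) + (\<integral>x. (p x - q x)\<^sup>2 \<partial>torus) / s) / 2"
      using v2 pq2 by simp
    also note small
    finally show ?thesis .
  qed
  have "\<forall>\<^sub>F n in sequentially. dist (conv_form (vp_kernel n) v q) (\<integral>x. v x * q x \<partial>torus) < e / 3"
    using e by (intro tendstoD conv_form_tendsto_continuous square_integrable_integrable v q) auto
  then show "\<forall>\<^sub>F n in sequentially. dist (conv_form (vp_kernel n) v p) (\<integral>x. v x * p x \<partial>torus) < e"
  proof eventually_elim
    case (elim n)
    then show ?case
      using B[of n] I unfolding dist_real_def by linarith
  qed
qed

section \<open>Integration by parts for periodic functions\<close>

lemma lborel_integral_shift:
  fixes f :: "'a::euclidean_space \<Rightarrow> real"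
  assumes "f \<in> borel_measurable borel"
  shows "(\<integral>x. f (c + x) \<partial>lborel) = (\<integral>x. f x \<partial>lborel)"
proof -
  have "(\<integral>x. f x \<partial>lborel) = (\<integral>x. f x \<partial>distr lborel borel ((+) c))"
    by (simp add: lborel_distr_plus)
  also have "\<dots> = (\<integral>x. f (c + x) \<partial>lborel)"
    using assms by (intro integral_distr) auto
  finally show ?thesis
    by simp
qed

text \<open>The integral over the torus does not change when the function is translated along an axis.\<close>

lemma integral_torus_shift_axis:
  fixes F :: "real ^ 'd::finite \<Rightarrow> real"
  assumes F: "continuous_on UNIV F" and per: "\<And>x. F (axis i 1 + x) = F x" and h: "0 < h" "h < 1"
  shows "(\<integral>x. F (h *\<^sub>R axis i 1 + x) \<partial>torus) = (\<integral>x. F x \<partial>torus)"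
proof -
  \<comment> \<open>
    The unit cube and its translate are the boxes over \<open>(0, 1]\<close> and \<open>(h, 1 + h]\<close> along the axis, up to a
    null set.  The part of the translate over \<open>(1, 1 + h]\<close> is moved to \<open>(0, h]\<close> by periodicity.
  \<close>
  define T where "T a b = {x :: real ^ 'd. (\<forall>j. j \<noteq> i \<longrightarrow> 0 \<le> x $ j \<and> x $ j \<le> 1) \<and> a < x $ i \<and> x $ i \<le> b}" for a b
  define J where "J f a b = (LINT x:T a b|lborel. f x)" for f :: "real ^ 'd \<Rightarrow> real" and a b
  have [measurable]: "T a b \<in> sets borel" for a b
  proof -
    have "T a b = (\<Inter>j. if j = i then {x. a < x $ j} \<inter> {x. x $ j \<le> b} else {x. 0 \<le> x $ j} \<inter> {x. x $ j \<le> 1})"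
      by (auto simp: T_def)
    also have "\<dots> \<in> sets borel"
      by (auto intro!: sets.finite_INT sets.Int
          borel_closed closed_Collect_le borel_open open_Collect_less continuous_intros)
    finally show ?thesis .
  qed
  have int: "set_integrable lborel (T a b) f" if "continuous_on UNIV f" for f :: "real ^ 'd \<Rightarrow> real" and a b
  proof (rule set_integrable_subset)
    let ?B = "cbox (\<chi> j. if j = i then a else 0) (\<chi> j. if j = i then b else 1) :: (real ^ 'd) set"
    show "set_integrable lborel ?B f"
      unfolding set_integrable_def
      by (intro borel_integrable_compact continuous_on_subset[OF that]) auto
    show "T a b \<subseteq> ?B"
      by (auto simp: T_def mem_box_cart)
  qed auto
  have join: "J f a c = J f a b + J f b c" if "continuous_on UNIV f" "a \<le> b" "b \<le> c" for f a b c
  proof -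
    have "T a c = T a b \<union> T b c" "T a b \<inter> T b c = {}"
      using that by (auto simp: T_def)
    then show ?thesis
      unfolding J_def using int[OF that(1)] by (simp add: set_integral_Un)
  qed
  have shift: "J (\<lambda>x. f (c *\<^sub>R axis i 1 + x)) a b = J f (c + a) (c + b)" if "continuous_on UNIV f" for f a b c
  proof -
    have [measurable]: "f \<in> borel_measurable borel"
      using that by (rule borel_measurable_continuous_onI)
    have "indicator (T a b) x = (indicator (T (c + a) (c + b)) (c *\<^sub>R axis i 1 + x) :: real)" for x
      by (auto simp: T_def axis_def indicator_def)
    then have "J (\<lambda>x. f (c *\<^sub>R axis i 1 + x)) a b =
        (\<integral>x. (\<lambda>x. indicator (T (c + a) (c + b)) x *\<^sub>R f x) (c *\<^sub>R axis i 1 + x) \<partial>lborel)"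
      by (simp add: J_def set_lebesgue_integral_def)
    also have "\<dots> = J f (c + a) (c + b)"
      unfolding J_def set_lebesgue_integral_def by (rule lborel_integral_shift) measurable
    finally show ?thesis .
  qed
  have torus_J: "(\<integral>x. f x \<partial>torus) = J f 0 1" if "continuous_on UNIV f" for f
  proof -
    have [measurable]: "f \<in> borel_measurable borel"
      using that by (rule borel_measurable_continuous_onI)
    have "negligible {x :: real ^ 'd. x \<bullet> axis i 1 = 0}"
      by (rule negligible_standard_hyperplane) (auto simp: Basis_vec_def)
    then have "AE x in lebesgue. x \<notin> {x :: real ^ 'd. x \<bullet> axis i 1 = 0}"
      by (intro AE_not_in) (simp add: negligible_iff_null_sets)
    then have "AE x in lborel. x \<notin> {x :: real ^ 'd. x \<bullet> axis i 1 = 0}"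
      by (simp only: AE_completion_iff)
    then have "AE x in lborel. indicator (cbox 0 1) x *\<^sub>R f x = indicator (T 0 1) x *\<^sub>R f x"
    proof eventually_elim
      case (elim x)
      then have "x $ i \<noteq> 0"
        by (simp add: inner_axis)
      then have "x \<in> cbox 0 1 \<longleftrightarrow> x \<in> T 0 1"
        unfolding T_def mem_box_cart by (auto simp: less_le)
      then show ?case
        by (simp add: indicator_def)
    qed
    then have "(\<integral>x. indicator (cbox 0 1) x *\<^sub>R f x \<partial>lborel) = J f 0 1"
      unfolding J_def set_lebesgue_integral_def by (intro integral_cong_AE) auto
    then show ?thesis
      unfolding torus_def by (subst integral_restrict_space) auto
  qed
  have cont_shift: "continuous_on UNIV (\<lambda>x. F (h *\<^sub>R axis i 1 + x))"
    by (rule continuous_on_compose2[OF F]) (auto intro!: continuous_intros)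
  have "(\<integral>x. F (h *\<^sub>R axis i 1 + x) \<partial>torus) = J F h (h + 1)"
    using shift[OF F, of h 0 1] by (simp add: torus_J[OF cont_shift])
  also have "\<dots> = J F h 1 + J F 1 (h + 1)"
    using h by (intro join F) auto
  also have "J F 1 (h + 1) = J F 0 h"
    using shift[OF F, of 1 0 h] per by (simp add: add.commute)
  also have "J F h 1 + J F 0 h = J F 0 1"
    using join[OF F, of 0 h 1] h by simp
  finally show ?thesis
    by (simp add: torus_J[OF F])
qed

lemma C1_periodic_derivative_along_axis:
  assumes "C1_periodic F G"
  shows "((\<lambda>t. F (t *\<^sub>R axis i 1 + x)) has_real_derivative G (t *\<^sub>R axis i 1 + x) $ i) (at t)"
proof -
  have "FDERIV F (t *\<^sub>R axis i 1 + x) :> (\<lambda>h. inner h (G (t *\<^sub>R axis i 1 + x)))"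
    using assms by (auto simp: C1_periodic_def gderiv_def)
  moreover have "((\<lambda>t. t *\<^sub>R axis i 1 + x) has_derivative (\<lambda>h. h *\<^sub>R axis i 1)) (at t)"
    by (auto intro!: derivative_eq_intros)
  ultimately have "((\<lambda>t. F (t *\<^sub>R axis i 1 + x)) has_derivative
      (\<lambda>h. inner (h *\<^sub>R axis i 1) (G (t *\<^sub>R axis i 1 + x)))) (at t)"
    using has_derivative_compose by blast
  then show ?thesis
    by (simp add: has_field_derivative_def inner_axis' mult_commute_abs)
qed

text \<open>
  The difference quotients along the axis have integral zero and converge boundedly to the derivative.
\<close>

lemma integral_torus_partial_eq_0:
  fixes F :: "real ^ 'd::finite \<Rightarrow> real"
  assumes C1: "C1_periodic F G"
  shows "(\<integral>x. G x $ i \<partial>torus) = 0"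
proof -
  let ?e = "axis i 1 :: real ^ 'd"
  define h where "h n = 1 / (real n + 2)" for n
  have h: "0 < h n" "h n < 1" for n
    by (auto simp: h_def)
  have per: "F (?e + x) = F x" for x
    using C1 by (simp add: C1_periodic_def add.commute)
  note F = C1_periodic_continuous(1)[OF C1]
  have cont: "continuous_on UNIV (\<lambda>x. F (c *\<^sub>R ?e + x))" for c
    by (rule continuous_on_compose2[OF F]) (auto intro!: continuous_intros)
  have int: "integrable torus f" if "continuous_on UNIV f" for f :: "real ^ 'd \<Rightarrow> real"
    using that by (intro square_integrable_integrable square_integrable_continuous)
  have "compact ((\<lambda>x. G x $ i) ` cbox 0 (2 :: real ^ 'd))"
    by (intro compact_continuous_image continuous_on_subset[OF C1_periodic_continuous(2)[OF C1]]) auto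
  then have "\<exists>C. \<forall>x\<in>cbox 0 (2 :: real ^ 'd). norm (G x $ i) \<le> C"
    by (auto dest!: compact_imp_bounded simp: bounded_iff)
  then obtain C where C: "\<And>x. x \<in> cbox 0 (2 :: real ^ 'd) \<Longrightarrow> \<bar>G x $ i\<bar> \<le> C"
    by auto
  have "(\<lambda>n. \<integral>x. (F (h n *\<^sub>R ?e + x) - F x) / h n \<partial>torus) \<longlonglongrightarrow> (\<integral>x. G x $ i \<partial>torus)"
  proof (rule integral_dominated_convergence)
    show "(\<lambda>x. G x $ i) \<in> borel_measurable torus"
      using int[OF C1_periodic_continuous(2)[OF C1, of i]] by auto
    show "(\<lambda>x. (F (h n *\<^sub>R ?e + x) - F x) / h n) \<in> borel_measurable torus" for n
      using int[OF cont[of "h n"]] int[OF F] by auto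
    show "integrable torus (\<lambda>x :: real ^ 'd. C)"
      by simp
    show "AE x in torus. (\<lambda>n. (F (h n *\<^sub>R ?e + x) - F x) / h n) \<longlonglongrightarrow> G x $ i"
    proof (rule AE_I2)
      fix x :: "real ^ 'd"
      have "((\<lambda>t. (F (t *\<^sub>R ?e + x) - F x) / t) \<longlongrightarrow> G x $ i) (at 0)"
        using C1_periodic_derivative_along_axis[OF C1, of i x 0] by (simp add: DERIV_def)
      moreover have "filterlim h (at 0) sequentially"
      proof -
        have "h \<longlonglongrightarrow> 0"
          unfolding h_def by real_asymp
        then show ?thesis
          using h(1) by (auto simp: filterlim_at less_imp_neq[symmetric])
      qed
      ultimately show "(\<lambda>n. (F (h n *\<^sub>R ?e + x) - F x) / h n) \<longlonglongrightarrow> G x $ i"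
        by (rule filterlim_compose)
    qed
    show "AE x in torus. norm ((F (h n *\<^sub>R ?e + x) - F x) / h n) \<le> C" for n
    proof (rule AE_I2)
      fix x :: "real ^ 'd" assume x: "x \<in> space torus"
      have "\<exists>z>0. z < h n \<and>
          F (h n *\<^sub>R ?e + x) - F (0 *\<^sub>R ?e + x) = (h n - 0) * G (z *\<^sub>R ?e + x) $ i"
        by (intro MVT2 h C1_periodic_derivative_along_axis C1)
      then obtain z where z: "0 < z" "z < h n"
        "F (h n *\<^sub>R ?e + x) - F (0 *\<^sub>R ?e + x) = (h n - 0) * G (z *\<^sub>R ?e + x) $ i"
        by blast
      have "z *\<^sub>R ?e + x \<in> cbox 0 2"
        unfolding mem_box_cart
      proof
        fix j
        have "0 \<le> x $ j" "x $ j \<le> 1"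
          using x by (auto simp: space_torus mem_box_cart)
        then show "0 $ j \<le> (z *\<^sub>R ?e + x) $ j \<and> (z *\<^sub>R ?e + x) $ j \<le> 2 $ j"
          using z(1,2) h(2)[of n] by (cases "j = i") (simp_all add: axis_def)
      qed
      from C[OF this] show "norm ((F (h n *\<^sub>R ?e + x) - F x) / h n) \<le> C"
        using z(3) h(1)[of n] by simp
    qed
  qed
  moreover have "(\<integral>x. (F (h n *\<^sub>R ?e + x) - F x) / h n \<partial>torus) = 0" for n
    using int[OF cont[of "h n"]] int[OF F] integral_torus_shift_axis[OF F per h, of n]
    by simp
  ultimately have "(\<lambda>n. 0) \<longlonglongrightarrow> (\<integral>x. G x $ i \<partial>torus)"
    by (simp only:)
  then show ?thesis
    by (simp add: LIMSEQ_const_iff)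
qed

lemma C1_periodic_by_parts:
  assumes "C1_periodic \<phi> G" "C1_periodic \<psi> H"
  shows "(\<integral>x. \<phi> x * (H x $ i) \<partial>torus) = - (\<integral>x. (G x $ i) * \<psi> x \<partial>torus)"
proof -
  have int: "integrable torus (\<lambda>x. a x * b x)" if "continuous_on UNIV a" "continuous_on UNIV b"
    for a b :: "real ^ 'a \<Rightarrow> real"
    using that by (intro square_integrable_mult square_integrable_continuous)
  have "(\<integral>x. (\<phi> x *\<^sub>R H x + \<psi> x *\<^sub>R G x) $ i \<partial>torus) = 0"
    by (rule integral_torus_partial_eq_0[OF C1_periodic_mult[OF assms]])
  then have "(\<integral>x. \<phi> x * (H x $ i) \<partial>torus) + (\<integral>x. (G x $ i) * \<psi> x \<partial>torus) = 0"
    using int[OF C1_periodic_continuous(1)[OF assms(1)] C1_periodic_continuous(2)[OF assms(2), of i]]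
      int[OF C1_periodic_continuous(2)[OF assms(1), of i] C1_periodic_continuous(1)[OF assms(2)]]
    by (simp add: mult.commute[of "\<psi> _"])
  then show ?thesis
    by simp
qed

section \<open>Weak derivatives\<close>

lemma C1_periodic_square_integrable:
  assumes "C1_periodic \<phi> G"
  shows "square_integrable \<phi>" "square_integrable (\<lambda>x. G x $ i)"
  using C1_periodic_continuous[OF assms] by (auto intro: square_integrable_continuous)

lemma has_weak_partial_abs:
  assumes "square_integrable v" "square_integrable g"
  shows "has_weak_partial i (abs_torus_L2 v) (abs_torus_L2 g) \<longleftrightarrow>
    (\<forall>\<phi> G. C1_periodic \<phi> G \<longrightarrow> (\<integral>x. v x * (G x $ i) \<partial>torus) = - (\<integral>x. g x * \<phi> x \<partial>torus))"
  using assms by (simp add: has_weak_partial.abs_eq)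

lemma has_weak_partial_iff_inner:
  "has_weak_partial i V W \<longleftrightarrow> (\<forall>\<phi> G. C1_periodic \<phi> G \<longrightarrow>
    inner V (abs_torus_L2 (\<lambda>x. G x $ i)) = - inner W (abs_torus_L2 \<phi>))"
proof -
  obtain v where v: "square_integrable v" "V = abs_torus_L2 v"
    by (rule torus_L2_rep)
  obtain w where w: "square_integrable w" "W = abs_torus_L2 w"
    by (rule torus_L2_rep)
  show ?thesis
    unfolding v(2) w(2) has_weak_partial_abs[OF v(1) w(1)]
    by (intro iff_allI imp_cong refl)
      (simp add: inner_abs_torus_L2 v(1) w(1) C1_periodic_square_integrable)
qed

lemma has_weak_partial_C1_periodic:
  assumes "C1_periodic \<phi> G"
  shows "has_weak_partial i (abs_torus_L2 \<phi>) (abs_torus_L2 (\<lambda>x. G x $ i))"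
  using C1_periodic_by_parts[OF assms]
  by (simp add: has_weak_partial_abs C1_periodic_square_integrable[OF assms])

text \<open>
  The test functions determine the sign of an element of \<open>L\<^sup>2\<close>, because a convolution with a nonnegative
  kernel is an integral against nonnegative test functions.
\<close>

lemma nonneg_if_nonneg_on_test_functions:
  fixes D :: "'d::finite torus_L2"
  assumes test: "\<And>\<phi> G. C1_periodic \<phi> G \<Longrightarrow> (\<And>x. 0 \<le> \<phi> x) \<Longrightarrow> 0 \<le> inner D (abs_torus_L2 \<phi>)"
  shows "0 \<le> D"
proof (subst nonneg_iff_inner_torus_L2, intro allI impI)
  fix P :: "'d torus_L2" assume P: "0 \<le> P"
  obtain d where d: "square_integrable d" "D = abs_torus_L2 d"
    by (rule torus_L2_rep)
  obtain p where p: "square_integrable p" "P = abs_torus_L2 p"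
    by (rule torus_L2_rep)
  have p_nonneg: "AE x in torus. 0 \<le> p x"
    using P p by (simp add: zero_torus_L2_def le_abs_torus_L2 square_integrable_0)
  have "0 \<le> conv_form (vp_kernel n) p d" for n
  proof -
    obtain G where G: "C1_periodic (vp_kernel n :: real ^ 'd \<Rightarrow> real) G"
      using C1_periodic_vp_kernel by blast
    have "0 \<le> (\<integral>y. vp_kernel n (x - y) * d y \<partial>torus)" for x
      using test[OF C1_periodic_reflect[OF G, of x]] d C1_periodic_square_integrable(1)[OF C1_periodic_reflect[OF G, of x]]
      by (simp add: vp_kernel_nonneg inner_abs_torus_L2 mult.commute)
    then show ?thesis
      unfolding conv_form_fst[OF continuous_on_vp_kernel square_integrable_integrable[OF p(1)]
          square_integrable_integrable[OF d(1)]]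
      using p_nonneg by (intro integral_nonneg_AE) (auto elim: eventually_mono)
  qed
  then have "0 \<le> (\<integral>x. p x * d x \<partial>torus)"
    using LIMSEQ_le_const[OF conv_form_vp_kernel_tendsto[OF p(1) d(1)]] by blast
  then show "0 \<le> inner D P"
    using p d by (simp add: inner_abs_torus_L2 mult.commute)
qed

lemma zero_if_orthogonal_to_test_functions:
  fixes D :: "'d::finite torus_L2"
  assumes "\<And>\<phi> G. C1_periodic \<phi> G \<Longrightarrow> inner D (abs_torus_L2 \<phi>) = 0"
  shows "D = 0"
proof (rule antisym)
  show "0 \<le> D"
    using assms by (intro nonneg_if_nonneg_on_test_functions) auto
  have "0 \<le> - D"
    using assms by (intro nonneg_if_nonneg_on_test_functions) auto
  then show "D \<le> 0"
    by simp
qed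

lemma has_weak_partial_unique:
  assumes "has_weak_partial i V W" "has_weak_partial i V W'"
  shows "W = W'"
proof -
  have "W - W' = 0"
  proof (rule zero_if_orthogonal_to_test_functions)
    fix \<phi> :: "real ^ 'a \<Rightarrow> real" and G assume "C1_periodic \<phi> G"
    then have "- inner W (abs_torus_L2 \<phi>) = - inner W' (abs_torus_L2 \<phi>)"
      using assms unfolding has_weak_partial_iff_inner by metis
    then show "inner (W - W') (abs_torus_L2 \<phi>) = 0"
      by (simp add: inner_diff_left)
  qed
  then show ?thesis
    by simp
qed

lemma weak_partial_eq: "has_weak_partial i V W \<Longrightarrow> weak_partial i V = W"
  unfolding weak_partial_def using has_weak_partial_unique by blast

lemma has_weak_partial_H1: "V \<in> H1 \<Longrightarrow> has_weak_partial i V (weak_partial i V)"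
  unfolding H1_def using weak_partial_eq by fastforce

lemma has_weak_partial_add:
  "has_weak_partial i V W \<Longrightarrow> has_weak_partial i V' W' \<Longrightarrow> has_weak_partial i (V + V') (W + W')"
  unfolding has_weak_partial_iff_inner by (simp add: inner_add_left)

lemma has_weak_partial_scaleR:
  "has_weak_partial i V W \<Longrightarrow> has_weak_partial i (c *\<^sub>R V) (c *\<^sub>R W)"
  unfolding has_weak_partial_iff_inner by simp

lemma has_weak_partial_0: "has_weak_partial i 0 0"
  unfolding has_weak_partial_iff_inner by simp

lemma has_weak_partial_limit:
  assumes "\<And>n. has_weak_partial i (V n) (W n)" "V \<longlonglongrightarrow> V'" "W \<longlonglongrightarrow> W'"
  shows "has_weak_partial i V' W'"
  unfolding has_weak_partial_iff_inner
proof (intro allI impI)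
  fix \<phi> :: "real ^ 'a \<Rightarrow> real" and G assume \<phi>: "C1_periodic \<phi> G"
  have "(\<lambda>n. inner (V n) (abs_torus_L2 (\<lambda>x. G x $ i))) \<longlonglongrightarrow> inner V' (abs_torus_L2 (\<lambda>x. G x $ i))"
    by (intro tendsto_intros assms(2))
  moreover have "(\<lambda>n. - inner (W n) (abs_torus_L2 \<phi>)) \<longlonglongrightarrow> - inner W' (abs_torus_L2 \<phi>)"
    by (intro tendsto_intros assms(3))
  moreover have "inner (V n) (abs_torus_L2 (\<lambda>x. G x $ i)) = - inner (W n) (abs_torus_L2 \<phi>)" for n
    using assms(1) \<phi> unfolding has_weak_partial_iff_inner by blast
  ultimately show "inner V' (abs_torus_L2 (\<lambda>x. G x $ i)) = - inner W' (abs_torus_L2 \<phi>)"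
    by (simp add: LIMSEQ_unique)
qed

lemma subspace_H1: "subspace H1"
proof (rule subspaceI)
  show "0 \<in> H1"
    unfolding H1_def using has_weak_partial_0 by blast
  show "V \<in> H1 \<Longrightarrow> W \<in> H1 \<Longrightarrow> V + W \<in> H1" for V W
    unfolding H1_def using has_weak_partial_add by blast
  show "V \<in> H1 \<Longrightarrow> c *\<^sub>R V \<in> H1" for c V
    unfolding H1_def using has_weak_partial_scaleR by blast
qed

lemma weak_partial_add:
  "V \<in> H1 \<Longrightarrow> W \<in> H1 \<Longrightarrow> weak_partial i (V + W) = weak_partial i V + weak_partial i W"
  by (intro weak_partial_eq has_weak_partial_add has_weak_partial_H1)

lemma weak_partial_scaleR:
  "V \<in> H1 \<Longrightarrow> weak_partial i (c *\<^sub>R V) = c *\<^sub>R weak_partial i V"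
  by (intro weak_partial_eq has_weak_partial_scaleR has_weak_partial_H1)

lemma C1_periodic_in_H1: "C1_periodic \<phi> G \<Longrightarrow> abs_torus_L2 \<phi> \<in> H1"
  unfolding H1_def using has_weak_partial_C1_periodic by blast

text \<open>
  Integration by parts extends from test functions to \<open>H\<^sup>1\<close>.  The translates of a kernel \<open>\<eta>\<close> are test
  functions in both variables, so in the double integral of \<open>V(x) \<eta>(x - y) Q(y)\<close> the derivative on
  \<open>P\<close> can be moved to \<open>\<eta>\<close> and from there to \<open>V\<close>.
\<close>

proposition has_weak_partial_by_parts:
  fixes V W P Q :: "'d::finite torus_L2"
  assumes VW: "has_weak_partial i V W" and PQ: "has_weak_partial i P Q"
  shows "inner V Q = - inner W P"
proof -
  obtain v where v: "square_integrable v" "V = abs_torus_L2 v"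
    by (rule torus_L2_rep)
  obtain w where w: "square_integrable w" "W = abs_torus_L2 w"
    by (rule torus_L2_rep)
  obtain p where p: "square_integrable p" "P = abs_torus_L2 p"
    by (rule torus_L2_rep)
  obtain q where q: "square_integrable q" "Q = abs_torus_L2 q"
    by (rule torus_L2_rep)
  note int = square_integrable_integrable
  have vw: "(\<integral>x. v x * (G x $ i) \<partial>torus) = - (\<integral>x. w x * \<phi> x \<partial>torus)" if "C1_periodic \<phi> G" for \<phi> G
    using VW that unfolding v(2) w(2) has_weak_partial_abs[OF v(1) w(1)] by blast
  have pq: "(\<integral>x. p x * (G x $ i) \<partial>torus) = - (\<integral>x. q x * \<phi> x \<partial>torus)" if "C1_periodic \<phi> G" for \<phi> G
    using PQ that unfolding p(2) q(2) has_weak_partial_abs[OF p(1) q(1)] by blast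
  have "conv_form (vp_kernel n) v q = - conv_form (vp_kernel n) w p" for n
  proof -
    obtain G where G: "C1_periodic (vp_kernel n :: real ^ 'd \<Rightarrow> real) G"
      using C1_periodic_vp_kernel by blast
    note ck = continuous_on_vp_kernel[of n]
    note cG = C1_periodic_continuous(2)[OF G, of i]
    have "conv_form (vp_kernel n) v q = (\<integral>x. v x * (\<integral>y. vp_kernel n (x - y) * q y \<partial>torus) \<partial>torus)"
      by (rule conv_form_fst[OF ck int[OF v(1)] int[OF q(1)]])
    also have "\<dots> = (\<integral>x. v x * (\<integral>y. (G (x - y) $ i) * p y \<partial>torus) \<partial>torus)"
      using pq[OF C1_periodic_reflect[OF G]] by (simp add: mult.commute)
    also have "\<dots> = conv_form (\<lambda>z. G z $ i) v p"
      by (rule conv_form_fst[OF cG int[OF v(1)] int[OF p(1)], symmetric])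
    also have "\<dots> = (\<integral>y. p y * (\<integral>x. (G (x - y) $ i) * v x \<partial>torus) \<partial>torus)"
      by (rule conv_form_snd[OF cG int[OF v(1)] int[OF p(1)]])
    also have "\<dots> = (\<integral>y. - (p y * (\<integral>x. vp_kernel n (x - y) * w x \<partial>torus)) \<partial>torus)"
      using vw[OF C1_periodic_translate[OF G]] by (simp add: mult.commute)
    also have "\<dots> = - conv_form (vp_kernel n) w p"
      by (simp add: conv_form_snd[OF ck int[OF w(1)] int[OF p(1)]])
    finally show ?thesis .
  qed
  then have "(\<lambda>n. - conv_form (vp_kernel n) w p) \<longlonglongrightarrow> (\<integral>x. v x * q x \<partial>torus)"
    using conv_form_vp_kernel_tendsto[OF v(1) q(1)] by simp
  moreover have "(\<lambda>n. - conv_form (vp_kernel n) w p) \<longlonglongrightarrow> - (\<integral>x. w x * p x \<partial>torus)"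
    by (intro tendsto_minus conv_form_vp_kernel_tendsto w p)
  ultimately show ?thesis
    using v w p q by (simp add: inner_abs_torus_L2 LIMSEQ_unique)
qed

section \<open>The elliptic operator\<close>

lemma weak_ellop_eq:
  "weak_ellop \<nu> lam u v =
    \<nu> * (\<Sum>i\<in>UNIV. inner (weak_partial i u) (weak_partial i v)) + lam * inner u v"
  by (simp add: weak_ellop_def weak_laplacian_def L2_to_Hminus1_def)

lemma weak_ellop_commute: "weak_ellop \<nu> lam u v = weak_ellop \<nu> lam v u"
  unfolding weak_ellop_eq by (simp add: inner_commute)

text \<open>
  The energy inner product of \<open>H\<^sup>1\<close> is the inner product of \<open>L\<^sup>2 \<times> (L\<^sup>2)\<^sup>d\<close> pulled back along
  \<open>v \<mapsto> (\<surd>\<lambda> v, \<surd>\<nu> \<nabla> v)\<close>.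
\<close>

definition energy_embedding ::
  "real \<Rightarrow> real \<Rightarrow> 'd::finite torus_L2 \<Rightarrow> 'd torus_L2 \<times> ('d torus_L2 ^ 'd)" where
  "energy_embedding \<nu> lam v = (sqrt lam *\<^sub>R v, \<chi> i. sqrt \<nu> *\<^sub>R weak_partial i v)"

lemma inner_energy_embedding:
  assumes "\<nu> > 0" "lam > 0"
  shows "inner (energy_embedding \<nu> lam u) (energy_embedding \<nu> lam v) = weak_ellop \<nu> lam u v"
  using assms
  by (simp add: energy_embedding_def weak_ellop_eq inner_prod_def inner_vec_def sum_distrib_left
      mult.assoc[symmetric])

lemma energy_embedding_add:
  assumes "u \<in> H1" "v \<in> H1"
  shows "energy_embedding \<nu> lam (u + v) = energy_embedding \<nu> lam u + energy_embedding \<nu> lam v"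
  using assms by (simp add: energy_embedding_def weak_partial_add vec_eq_iff scaleR_add_right)

lemma energy_embedding_scaleR:
  assumes "v \<in> H1"
  shows "energy_embedding \<nu> lam (c *\<^sub>R v) = c *\<^sub>R energy_embedding \<nu> lam v"
  using assms by (simp add: energy_embedding_def weak_partial_scaleR vec_eq_iff)

lemma energy_embedding_diff:
  assumes "u \<in> H1" "v \<in> H1"
  shows "energy_embedding \<nu> lam (u - v) = energy_embedding \<nu> lam u - energy_embedding \<nu> lam v"
  using energy_embedding_add[OF assms(1) subspace_scale[OF subspace_H1 assms(2), of "-1"]]
    energy_embedding_scaleR[OF assms(2), of \<nu> lam "-1"]
  by simp

lemma subspace_energy_embedding:
  "subspace (energy_embedding \<nu> lam ` (H1 :: 'd::finite torus_L2 set))" (is "subspace (?E ` _)")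
proof (rule subspaceI)
  have "?E (0 *\<^sub>R 0) = 0"
    by (subst energy_embedding_scaleR) (simp_all add: subspace_0[OF subspace_H1])
  then show "0 \<in> ?E ` H1"
    using subspace_0[OF subspace_H1] by (intro image_eqI[of _ _ 0]) auto
  fix x assume "x \<in> ?E ` H1"
  then obtain v where v: "v \<in> H1" "x = ?E v"
    by blast
  show "c *\<^sub>R x \<in> ?E ` H1" for c
    using v subspace_scale[OF subspace_H1 v(1), of c] energy_embedding_scaleR[OF v(1), of \<nu> lam c]
    by (intro image_eqI[of _ _ "c *\<^sub>R v"]) auto
  fix y assume "y \<in> ?E ` H1"
  then obtain w where w: "w \<in> H1" "y = ?E w"
    by blast
  show "x + y \<in> ?E ` H1"
    using v w subspace_add[OF subspace_H1 v(1) w(1)] energy_embedding_add[OF v(1) w(1), of \<nu> lam]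
    by (intro image_eqI[of _ _ "v + w"]) auto
qed

lemma complete_energy_embedding:
  assumes "\<nu> > 0" "lam > 0"
  shows "complete (energy_embedding \<nu> lam ` (H1 :: 'd::finite torus_L2 set))"
  unfolding complete_def
proof (intro allI impI)
  fix s :: "nat \<Rightarrow> 'd torus_L2 \<times> ('d torus_L2 ^ 'd)"
  assume s: "(\<forall>n. s n \<in> energy_embedding \<nu> lam ` H1) \<and> Cauchy s"
  then obtain z where z: "s \<longlonglongrightarrow> z"
    using Cauchy_convergent convergent_def by blast
  have "\<forall>n. \<exists>v. v \<in> H1 \<and> s n = energy_embedding \<nu> lam v"
    using s by blast
  then obtain V where V: "\<And>n. V n \<in> H1" "\<And>n. s n = energy_embedding \<nu> lam (V n)"
    by metis
  let ?v = "fst z /\<^sub>R sqrt lam" and ?w = "\<lambda>i. snd z $ i /\<^sub>R sqrt \<nu>"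
  have "(\<lambda>n. fst (s n) /\<^sub>R sqrt lam) \<longlonglongrightarrow> ?v"
    by (intro tendsto_intros z)
  then have lim_v: "V \<longlonglongrightarrow> ?v"
    using assms by (simp add: V(2) energy_embedding_def)
  have "(\<lambda>n. snd (s n) $ i /\<^sub>R sqrt \<nu>) \<longlonglongrightarrow> ?w i" for i
    by (intro tendsto_intros z)
  then have "(\<lambda>n. weak_partial i (V n)) \<longlonglongrightarrow> ?w i" for i
    using assms by (simp add: V(2) energy_embedding_def)
  then have weak: "has_weak_partial i ?v (?w i)" for i
    using V(1) lim_v by (intro has_weak_partial_limit[OF has_weak_partial_H1])
  then have "?v \<in> H1"
    unfolding H1_def by blast
  moreover have "energy_embedding \<nu> lam ?v = z"
    using assms weak_partial_eq[OF weak] by (simp add: energy_embedding_def prod_eq_iff vec_eq_iff)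
  ultimately show "\<exists>l\<in>energy_embedding \<nu> lam ` H1. s \<longlonglongrightarrow> l"
    using z by (metis image_eqI)
qed

lemma weak_ellop_ge:
  assumes "\<nu> > 0"
  shows "lam * (norm v)\<^sup>2 \<le> weak_ellop \<nu> lam v v"
  using assms by (simp add: weak_ellop_eq power2_norm_eq_inner sum_nonneg)

lemma weak_ellop_diff_left:
  assumes "\<nu> > 0" "lam > 0" "u \<in> H1" "u' \<in> H1"
  shows "weak_ellop \<nu> lam (u - u') v = weak_ellop \<nu> lam u v - weak_ellop \<nu> lam u' v"
  using assms
  by (simp add: inner_energy_embedding[symmetric] energy_embedding_diff inner_diff_left)

lemma norm_le_H1_norm: "norm v \<le> H1_norm v"
  unfolding H1_norm_def by (rule real_le_rsqrt) (simp add: sum_nonneg)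

lemma L2_to_Hminus1_in_Hminus1: "L2_to_Hminus1 g \<in> Hminus1"
proof -
  have "\<bar>inner g v\<bar> \<le> norm g * H1_norm v" for v
    using order_trans[OF Cauchy_Schwarz_ineq2 mult_left_mono[OF norm_le_H1_norm norm_ge_zero]] .
  then show ?thesis
    by (auto simp: Hminus1_def L2_to_Hminus1_def inner_add_right)
qed

lemma H1_norm_le_energy:
  assumes "\<nu> > 0" "lam > 0"
  shows "H1_norm v \<le> norm (energy_embedding \<nu> lam v) / sqrt (min \<nu> lam)"
proof -
  have "min \<nu> lam * ((norm v)\<^sup>2 + (\<Sum>i\<in>UNIV. (norm (weak_partial i v))\<^sup>2)) \<le> weak_ellop \<nu> lam v v"
    unfolding weak_ellop_eq power2_norm_eq_inner[symmetric] distrib_left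
    by (subst add.commute) (intro add_mono mult_right_mono sum_nonneg; simp)
  also have "\<dots> = (norm (energy_embedding \<nu> lam v))\<^sup>2"
    using assms by (simp add: power2_norm_eq_inner inner_energy_embedding)
  finally have "sqrt (min \<nu> lam) * H1_norm v \<le> norm (energy_embedding \<nu> lam v)"
    unfolding H1_norm_def real_sqrt_mult[symmetric] by (rule real_le_lsqrt[OF norm_ge_zero])
  then show ?thesis
    using assms by (simp add: pos_le_divide_eq mult.commute)
qed

text \<open>
  The Riesz representation on the image of \<open>H\<^sup>1\<close> under the energy embedding: this is the assertion that
  \<open>L\<close> is a bijection from \<open>H\<^sup>1\<close> onto \<open>H\<^sup>-\<^sup>1\<close>.
\<close>

lemma ex1_weak_solution:
  fixes \<rho> :: "'d::finite torus_L2 \<Rightarrow> real"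
  assumes pos: "\<nu> > 0" "lam > 0" and \<rho>: "\<rho> \<in> Hminus1"
  shows "\<exists>!w. w \<in> H1 \<and> (\<forall>v\<in>H1. weak_ellop \<nu> lam w v = \<rho> v)"
proof (rule ex_ex1I)
  let ?E = "energy_embedding \<nu> lam"
  have add: "\<rho> (v + w) = \<rho> v + \<rho> w" if "v \<in> H1" "w \<in> H1" for v w
    using \<rho> that by (simp add: Hminus1_def)
  have scale: "\<rho> (c *\<^sub>R v) = c * \<rho> v" if "v \<in> H1" for c v
    using \<rho> that by (simp add: Hminus1_def)
  have "\<exists>C. \<forall>v\<in>H1. \<bar>\<rho> v\<bar> \<le> C * H1_norm v"
    using \<rho> by (simp add: Hminus1_def)
  then obtain C where C: "\<And>v. v \<in> H1 \<Longrightarrow> \<bar>\<rho> v\<bar> \<le> C * H1_norm v"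
    by blast
  \<comment> \<open>The functional \<open>\<rho>\<close> transported to the image; the first component determines \<open>v\<close>.\<close>
  define l where "l z = \<rho> (fst z /\<^sub>R sqrt lam)" for z :: "'d torus_L2 \<times> ('d torus_L2 ^ 'd)"
  have l: "l (?E v) = \<rho> v" for v
    using pos by (simp add: l_def energy_embedding_def)
  have l_bound: "\<bar>l z\<bar> \<le> \<bar>C\<bar> / sqrt (min \<nu> lam) * norm z" if z: "z \<in> ?E ` H1" for z
  proof -
    obtain v where v: "v \<in> H1" "z = ?E v"
      using z by blast
    have "\<bar>\<rho> v\<bar> \<le> \<bar>C\<bar> * H1_norm v"
      using C[OF v(1)] mult_right_mono[OF abs_ge_self[of C] order_trans[OF norm_ge_zero norm_le_H1_norm[of v]]]
      by linarith
    also have "\<dots> \<le> \<bar>C\<bar> * (norm (?E v) / sqrt (min \<nu> lam))"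
      by (intro mult_left_mono H1_norm_le_energy pos) simp
    finally show ?thesis
      by (simp add: v(2) l)
  qed
  have l_add: "l (x + y) = l x + l y" if "x \<in> ?E ` H1" "y \<in> ?E ` H1" for x y
    using that by (auto simp: energy_embedding_add[symmetric] l add)
  have l_scale: "l (c *\<^sub>R x) = c * l x" if "x \<in> ?E ` H1" for c x
    using that by (auto simp: energy_embedding_scaleR[symmetric] l scale)
  have "\<exists>z\<in>?E ` H1. \<forall>y\<in>?E ` H1. l y = inner z y"
    using l_add l_scale l_bound
    by (rule riesz_representation_complete_subspace[OF subspace_energy_embedding complete_energy_embedding[OF pos]])
  then obtain w where w: "w \<in> H1" "\<And>v. v \<in> H1 \<Longrightarrow> l (?E v) = inner (?E w) (?E v)"
    by blast
  then show "\<exists>w. w \<in> H1 \<and> (\<forall>v\<in>H1. weak_ellop \<nu> lam w v = \<rho> v)"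
    unfolding l inner_energy_embedding[OF pos] by force
  show "w = w'" if w: "w \<in> H1 \<and> (\<forall>v\<in>H1. weak_ellop \<nu> lam w v = \<rho> v)"
    and w': "w' \<in> H1 \<and> (\<forall>v\<in>H1. weak_ellop \<nu> lam w' v = \<rho> v)" for w w'
  proof -
    have "w - w' \<in> H1"
      using w w' subspace_diff[OF subspace_H1] by blast
    then have "weak_ellop \<nu> lam (w - w') (w - w') = 0"
      using w w' by (simp add: weak_ellop_diff_left[OF pos])
    then have "lam * (norm (w - w'))\<^sup>2 \<le> 0"
      using weak_ellop_ge[OF pos(1), of lam "w - w'"] by simp
    then show ?thesis
      using pos(2) by (simp add: mult_le_0_iff)
  qed
qed

lemma ellop_inv_props:
  assumes "\<nu> > 0" "lam > 0" "\<rho> \<in> Hminus1"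
  shows ellop_inv_H1: "ellop_inv \<nu> lam \<rho> \<in> H1"
    and weak_ellop_ellop_inv: "v \<in> H1 \<Longrightarrow> weak_ellop \<nu> lam (ellop_inv \<nu> lam \<rho>) v = \<rho> v"
    and ellop_inv_eqI: "w \<in> H1 \<Longrightarrow> (\<And>v. v \<in> H1 \<Longrightarrow> weak_ellop \<nu> lam w v = \<rho> v) \<Longrightarrow>
      ellop_inv \<nu> lam \<rho> = w"
proof -
  note ex1 = ex1_weak_solution[OF assms]
  have "ellop_inv \<nu> lam \<rho> \<in> H1 \<and> (\<forall>v\<in>H1. weak_ellop \<nu> lam (ellop_inv \<nu> lam \<rho>) v = \<rho> v)"
    unfolding ellop_inv_def by (rule theI'[OF ex1])
  then show "ellop_inv \<nu> lam \<rho> \<in> H1" "v \<in> H1 \<Longrightarrow> weak_ellop \<nu> lam (ellop_inv \<nu> lam \<rho>) v = \<rho> v"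
    by auto
  show "w \<in> H1 \<Longrightarrow> (\<And>v. v \<in> H1 \<Longrightarrow> weak_ellop \<nu> lam w v = \<rho> v) \<Longrightarrow> ellop_inv \<nu> lam \<rho> = w"
    unfolding ellop_inv_def by (rule the1_equality[OF ex1]) blast
qed

lemma weak_ellop_H2:
  assumes "u \<in> H2" "v \<in> H1"
  shows "weak_ellop \<nu> lam u v = inner (ellop \<nu> lam u) v"
proof -
  have "inner (weak_partial i u) (weak_partial i v) = - inner (weak_partial i (weak_partial i u)) v" for i
    using assms by (intro has_weak_partial_by_parts[of i] has_weak_partial_H1) (auto simp: H2_def)
  then show ?thesis
    by (simp add: weak_ellop_eq ellop_def laplacian_def inner_diff_left inner_add_left inner_sum_left sum_negf)
qed

section \<open>The convex set \<open>K\<close>\<close>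

lemma K_tilde_iff:
  assumes "\<nu> > 0" "lam > 0"
  shows "g \<in> K_tilde \<nu> lam \<longleftrightarrow> (\<exists>w\<in>H1. w \<le> 0 \<and> (\<forall>v\<in>H1. weak_ellop \<nu> lam w v = inner g v))"
proof -
  note props = ellop_inv_props[OF assms L2_to_Hminus1_in_Hminus1[of g]]
  show ?thesis
  proof
    assume "g \<in> K_tilde \<nu> lam"
    then have "ellop_inv \<nu> lam (L2_to_Hminus1 g) \<le> 0"
      by (simp add: K_tilde_def)
    then show "\<exists>w\<in>H1. w \<le> 0 \<and> (\<forall>v\<in>H1. weak_ellop \<nu> lam w v = inner g v)"
      using props(1,2) by (intro bexI[of _ "ellop_inv \<nu> lam (L2_to_Hminus1 g)"]) (auto simp: L2_to_Hminus1_def)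
  next
    assume "\<exists>w\<in>H1. w \<le> 0 \<and> (\<forall>v\<in>H1. weak_ellop \<nu> lam w v = inner g v)"
    then obtain w where w: "w \<in> H1" "w \<le> 0" "\<And>v. v \<in> H1 \<Longrightarrow> weak_ellop \<nu> lam w v = inner g v"
      by blast
    then have "ellop_inv \<nu> lam (L2_to_Hminus1 g) = w"
      by (intro props(3)) (auto simp: L2_to_Hminus1_def)
    then show "g \<in> K_tilde \<nu> lam"
      using w(2) by (simp add: K_tilde_def)
  qed
qed

lemma convex_K_tilde:
  assumes pos: "\<nu> > 0" "lam > 0"
  shows "convex (K_tilde \<nu> lam)"
proof (rule convexI)
  fix g h :: "'a torus_L2" and s t :: real
  assume "g \<in> K_tilde \<nu> lam" "h \<in> K_tilde \<nu> lam" and st: "0 \<le> s" "0 \<le> t" "s + t = 1"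
  then obtain a b where a: "a \<in> H1" "a \<le> 0" "\<And>v. v \<in> H1 \<Longrightarrow> weak_ellop \<nu> lam a v = inner g v"
    and b: "b \<in> H1" "b \<le> 0" "\<And>v. v \<in> H1 \<Longrightarrow> weak_ellop \<nu> lam b v = inner h v"
    unfolding K_tilde_iff[OF pos] by blast
  have sa: "s *\<^sub>R a \<in> H1" and tb: "t *\<^sub>R b \<in> H1"
    using a b subspace_scale[OF subspace_H1] by blast+
  show "s *\<^sub>R g + t *\<^sub>R h \<in> K_tilde \<nu> lam"
    unfolding K_tilde_iff[OF pos]
  proof (intro bexI conjI ballI)
    show "s *\<^sub>R a + t *\<^sub>R b \<in> H1"
      using sa tb by (rule subspace_add[OF subspace_H1])
    show "s *\<^sub>R a + t *\<^sub>R b \<le> 0"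
      using a b st by (intro add_nonpos_nonpos scaleR_nonneg_nonpos)
    show "weak_ellop \<nu> lam (s *\<^sub>R a + t *\<^sub>R b) v = inner (s *\<^sub>R g + t *\<^sub>R h) v" if "v \<in> H1" for v
      using a(3)[OF that] b(3)[OF that]
      by (simp add: inner_energy_embedding[OF pos, symmetric] energy_embedding_add[OF sa tb]
          energy_embedding_scaleR a(1) b(1) inner_add_left)
  qed
qed

text \<open>\<open>L\<^sup>-\<^sup>1\<close> is continuous on \<open>L\<^sup>2\<close> with constant \<open>1 / \<lambda>\<close>, and the order is closed.\<close>

lemma complete_K_tilde:
  assumes pos: "\<nu> > 0" "lam > 0"
  shows "complete (K_tilde \<nu> lam :: 'd::finite torus_L2 set)"
  unfolding complete_def
proof (intro allI impI)
  fix g :: "nat \<Rightarrow> 'd torus_L2"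
  assume g: "(\<forall>n. g n \<in> K_tilde \<nu> lam) \<and> Cauchy g"
  then obtain h where h: "g \<longlonglongrightarrow> h"
    using Cauchy_convergent convergent_def by blast
  obtain a where a: "\<And>n. a n \<in> H1" "\<And>n. a n \<le> 0" "\<And>n v. v \<in> H1 \<Longrightarrow> weak_ellop \<nu> lam (a n) v = inner (g n) v"
    using g unfolding K_tilde_iff[OF pos] by metis
  let ?b = "ellop_inv \<nu> lam (L2_to_Hminus1 h)"
  have b: "?b \<in> H1" "\<And>v. v \<in> H1 \<Longrightarrow> weak_ellop \<nu> lam ?b v = inner h v"
    using ellop_inv_props(1,2)[OF pos L2_to_Hminus1_in_Hminus1[of h]] by (auto simp: L2_to_Hminus1_def)
  have "norm (a n - ?b) \<le> norm (g n - h) / lam" for n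
  proof -
    have "a n - ?b \<in> H1"
      using a(1) b(1) by (rule subspace_diff[OF subspace_H1])
    then have "weak_ellop \<nu> lam (a n - ?b) (a n - ?b) = inner (g n - h) (a n - ?b)"
      by (simp add: weak_ellop_diff_left[OF pos a(1) b(1)] a(3) b(2) inner_diff_left)
    then have "lam * (norm (a n - ?b))\<^sup>2 \<le> norm (g n - h) * norm (a n - ?b)"
      using weak_ellop_ge[OF pos(1), of lam "a n - ?b"] norm_cauchy_schwarz[of "g n - h" "a n - ?b"] by linarith
    then show ?thesis
      using pos(2) by (cases "norm (a n - ?b) = 0") (auto simp: power2_eq_square pos_le_divide_eq mult.commute)
  qed
  moreover have "(\<lambda>n. norm (g n - h) / lam) \<longlonglongrightarrow> norm (h - h) / lam"
    using pos by (intro tendsto_intros h) auto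
  then have "(\<lambda>n. norm (g n - h) / lam) \<longlonglongrightarrow> 0"
    by simp
  ultimately have "(\<lambda>n. a n - ?b) \<longlonglongrightarrow> 0"
    by (intro Lim_null_comparison[of "\<lambda>n. a n - ?b"]) auto
  then have "a \<longlonglongrightarrow> ?b"
    by (simp add: Lim_null[symmetric] LIM_zero_iff)
  then have "?b \<le> 0"
    using a(2) by (rule nonpos_limit_torus_L2[rotated])
  then have "h \<in> K_tilde \<nu> lam"
    by (simp add: K_tilde_def)
  with h show "\<exists>l\<in>K_tilde \<nu> lam. g \<longlonglongrightarrow> l"
    by blast
qed

section \<open>The system and the iteration\<close>

lemma residual_eq_diff_ellop:
  "x + \<nu> *\<^sub>R laplacian u - lam *\<^sub>R u = x - ellop \<nu> lam u"
  by (simp add: ellop_def)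

text \<open>
  A solution of the system satisfies two variational inequalities in \<open>L\<^sup>2\<close>, one on the cone of
  nonnegative functions and one on \<open>K\<close>.
\<close>

lemma mfg_solution_variational:
  assumes pos: "\<nu> > 0" "lam > 0" and \<rho>: "\<rho> \<in> Hminus1" and sol: "mfg_solution \<nu> lam \<rho> f u m"
  shows mfg_solution_cone: "\<mu> \<ge> 0 \<Longrightarrow> inner (f m - ellop \<nu> lam u) (\<mu> - m) \<ge> 0"
    and mfg_solution_in_K: "ellop \<nu> lam u \<in> K_tilde \<nu> lam"
    and mfg_solution_K: "h \<in> K_tilde \<nu> lam \<Longrightarrow>
      inner (m - ellop_inv \<nu> lam \<rho>) (h - ellop \<nu> lam u) \<ge> 0"
proof -
  have u: "u \<in> H2" "u \<in> H1" "u \<le> 0" and m: "m \<in> H1" "m \<ge> 0"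
    and obstacle: "\<And>v. v \<in> H1 \<Longrightarrow> v \<le> 0 \<Longrightarrow> inner (f m - ellop \<nu> lam u) (v - u) \<le> 0"
    and transport: "\<And>v. v \<in> H1 \<Longrightarrow> v \<le> 0 \<Longrightarrow> weak_ellop \<nu> lam m (v - u) - \<rho> (v - u) \<ge> 0"
    and compl: "inner (f m - ellop \<nu> lam u) m = 0"
    using sol unfolding mfg_solution_def residual_eq_diff_ellop L2_to_Hminus1_def
    by (auto simp: H2_def)
  \<comment> \<open>\<open>u - p\<close> is an admissible competitor for every nonnegative test function \<open>p\<close>.\<close>
  have "0 \<le> f m - ellop \<nu> lam u"
  proof (rule nonneg_if_nonneg_on_test_functions)
    fix \<phi> :: "real ^ 'a \<Rightarrow> real" and G
    assume \<phi>: "C1_periodic \<phi> G" "\<And>x. 0 \<le> \<phi> x"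
    let ?p = "abs_torus_L2 \<phi>"
    have "?p \<ge> 0"
      using \<phi>(2) C1_periodic_square_integrable(1)[OF \<phi>(1)]
      by (simp add: zero_torus_L2_def le_abs_torus_L2 square_integrable_0)
    then have "u - ?p \<le> 0"
      using u(3) by (metis diff_0_right diff_mono)
    then show "0 \<le> inner (f m - ellop \<nu> lam u) ?p"
      using obstacle[of "u - ?p"] subspace_diff[OF subspace_H1 u(2) C1_periodic_in_H1[OF \<phi>(1)]] by simp
  qed
  then show "\<mu> \<ge> 0 \<Longrightarrow> inner (f m - ellop \<nu> lam u) (\<mu> - m) \<ge> 0"
    using compl inner_nonneg_torus_L2[of "f m - ellop \<nu> lam u" \<mu>] by (simp add: inner_diff_right)
  show "ellop \<nu> lam u \<in> K_tilde \<nu> lam"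
    unfolding K_tilde_iff[OF pos] using u weak_ellop_H2 by blast
  show "inner (m - ellop_inv \<nu> lam \<rho>) (h - ellop \<nu> lam u) \<ge> 0" if h: "h \<in> K_tilde \<nu> lam"
  proof -
    obtain v where v: "v \<in> H1" "v \<le> 0" "\<And>\<phi>. \<phi> \<in> H1 \<Longrightarrow> weak_ellop \<nu> lam v \<phi> = inner h \<phi>"
      using h unfolding K_tilde_iff[OF pos] by blast
    let ?w = "ellop_inv \<nu> lam \<rho>"
    have w: "?w \<in> H1"
      by (rule ellop_inv_H1[OF pos \<rho>])
    have pair: "weak_ellop \<nu> lam \<phi> (v - u) = inner \<phi> (h - ellop \<nu> lam u)" if "\<phi> \<in> H1" for \<phi>
      using that v(3)[OF that] weak_ellop_H2[OF u(1) that]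
      by (simp add: weak_ellop_commute[of _ _ \<phi>] weak_ellop_diff_left[OF pos v(1) u(2)]
          inner_diff_right inner_commute)
    have "\<rho> (v - u) = weak_ellop \<nu> lam ?w (v - u)"
      using weak_ellop_ellop_inv[OF pos \<rho> subspace_diff[OF subspace_H1 v(1) u(2)]] by simp
    then show ?thesis
      using transport[OF v(1,2)] pair[OF m(1)] pair[OF w] by (simp add: inner_diff_left)
  qed
qed

text \<open>The solution \<open>m\<close> of the cone inequality depends on \<open>g\<close> in an \<open>\<alpha>\<close>-cocoercive way.\<close>

lemma cone_inequality_cocoercive:
  fixes f :: "'d::finite torus_L2 \<Rightarrow> 'd torus_L2"
  assumes mono: "alpha_monotone \<alpha> f" and nonneg: "m \<ge> 0" "m' \<ge> 0"
    and m: "\<And>\<mu>. \<mu> \<ge> 0 \<Longrightarrow> inner (f m - g) (\<mu> - m) \<ge> 0"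
    and m': "\<And>\<mu>. \<mu> \<ge> 0 \<Longrightarrow> inner (f m' - g') (\<mu> - m') \<ge> 0"
  shows "\<alpha> * (norm (m - m'))\<^sup>2 \<le> inner (g - g') (m - m')"
proof -
  have "\<alpha> * (norm (m - m'))\<^sup>2 \<le> inner (f m - f m') (m - m')"
    using mono by (simp add: alpha_monotone_def)
  with m[OF nonneg(2)] m'[OF nonneg(1)] show ?thesis
    by (simp add: inner_diff_left inner_diff_right)
qed

lemma mfg_solution_unique:
  assumes pos: "\<nu> > 0" "lam > 0" "\<alpha> > 0" and \<rho>: "\<rho> \<in> Hminus1" and mono: "alpha_monotone \<alpha> f"
    and sol: "mfg_solution \<nu> lam \<rho> f u m" and sol': "mfg_solution \<nu> lam \<rho> f u' m'"
  shows "u' = u \<and> m' = m"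
proof
  let ?g = "ellop \<nu> lam u" and ?g' = "ellop \<nu> lam u'"
  note vi = mfg_solution_variational[OF pos(1,2) \<rho> sol] and vi' = mfg_solution_variational[OF pos(1,2) \<rho> sol']
  have nonneg: "m \<ge> 0" "m' \<ge> 0"
    using sol sol' by (auto simp: mfg_solution_def)
  have "\<alpha> * (norm (m' - m))\<^sup>2 \<le> inner (?g' - ?g) (m' - m)"
    by (rule cone_inequality_cocoercive[OF mono nonneg(2,1) vi'(1) vi(1)])
  also have "\<dots> \<le> 0"
    using vi(3)[OF vi'(2)] vi'(3)[OF vi(2)]
    by (simp add: inner_diff_left inner_diff_right inner_commute)
  finally show m_eq: "m' = m"
    using pos(3) by (simp add: mult_le_0_iff)
  have u: "u \<in> H2" "u \<in> H1" "u \<le> 0" and u': "u' \<in> H2" "u' \<in> H1" "u' \<le> 0"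
    using sol sol' by (auto simp: mfg_solution_def H2_def)
  have "inner (f m - ?g) (u' - u) \<le> 0" "inner (f m - ?g') (u - u') \<le> 0"
    using sol sol' u u' unfolding mfg_solution_def residual_eq_diff_ellop L2_to_Hminus1_def m_eq by auto
  then have "inner (?g' - ?g) (u' - u) \<le> 0"
    by (simp add: inner_diff_left inner_diff_right)
  moreover have "u' - u \<in> H1"
    using u' u by (intro subspace_diff[OF subspace_H1])
  then have "weak_ellop \<nu> lam (u' - u) (u' - u) = inner (?g' - ?g) (u' - u)"
    by (simp add: weak_ellop_diff_left[OF pos(1,2) u'(2) u(2)] weak_ellop_H2 u u' inner_diff_left)
  ultimately have "lam * (norm (u' - u))\<^sup>2 \<le> 0"
    using weak_ellop_ge[OF pos(1), of lam "u' - u"] by simp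
  then show "u' = u"
    using pos(2) by (simp add: mult_le_0_iff)
qed

lemma tendsto_0_if_dissipated:
  fixes a d :: "nat \<Rightarrow> real"
  assumes "c > 0" and "\<And>n. 0 \<le> a n" "\<And>n. 0 \<le> d n" and diss: "\<And>n. a (Suc n) \<le> a n - c * d n"
  shows "d \<longlonglongrightarrow> 0"
proof -
  have "0 \<le> c * d n" for n
    using assms(1,3) by simp
  then have "decseq a"
    using diss by (intro decseq_SucI) (smt (verit))
  then obtain L where L: "a \<longlonglongrightarrow> L"
    using assms(2) decseq_convergent[of a 0] by blast
  have lim: "(\<lambda>n. (a n - a (Suc n)) / c) \<longlonglongrightarrow> (L - L) / c"
    using assms(1) by (intro tendsto_intros L LIMSEQ_Suc) auto
  have le: "d n \<le> (a n - a (Suc n)) / c" for n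
    using diss[of n] assms(1) by (simp add: pos_le_divide_eq mult.commute)
  show ?thesis
    by (rule tendsto_sandwich[OF _ _ tendsto_const lim[simplified]]) (use assms(3) le in auto)
qed

theorem theorem3:
  fixes \<nu> lam \<alpha> \<delta> :: real
    and \<rho> :: "'d::finite torus_L2 \<Rightarrow> real"
    and f :: "'d torus_L2 \<Rightarrow> 'd torus_L2"
    and us ms :: "nat \<Rightarrow> 'd torus_L2"
    and u m :: "'d torus_L2"
  assumes "\<nu> > 0" and "lam > 0"
    and "\<rho> \<in> Hminus1"
    and "continuous_on UNIV f"
    and "\<alpha> > 0" and "alpha_monotone \<alpha> f"
    and "0 < \<delta>" and "\<delta> < 2 * \<alpha>"
    and "us 0 \<in> H2" and "us 0 \<le> 0"
    and "\<And>n. ms n \<ge> 0"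
    and "\<And>n \<mu>. \<mu> \<ge> 0 \<Longrightarrow>
           inner (f (ms n) + \<nu> *\<^sub>R laplacian (us n) - lam *\<^sub>R us n) (\<mu> - ms n) \<ge> 0"
    and "\<And>n. us (Suc n) \<in> H2"
    and "\<And>n. ellop \<nu> lam (us (Suc n)) =
           proj_on (K_tilde \<nu> lam)
             (ellop \<nu> lam (us n) - \<delta> *\<^sub>R (ms n - ellop_inv \<nu> lam \<rho>))"
    and "mfg_solution \<nu> lam \<rho> f u m"
  shows "(\<forall>u' m'. mfg_solution \<nu> lam \<rho> f u' m' \<longrightarrow> u' = u \<and> m' = m) \<and> ms \<longlonglongrightarrow> m"
proof (intro conjI allI impI)
  note pos = assms(1,2) and \<rho> = assms(3) and mono = assms(6) and sol = assms(15)
  show "u' = u" "m' = m" if "mfg_solution \<nu> lam \<rho> f u' m'" for u' m'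
    using mfg_solution_unique[OF pos assms(5) \<rho> mono sol that] by auto
  let ?K = "K_tilde \<nu> lam :: 'd torus_L2 set" and ?w = "ellop_inv \<nu> lam \<rho>"
  define g where "g = ellop \<nu> lam u"
  define gs where "gs n = ellop \<nu> lam (us n)" for n
  note vi = mfg_solution_variational[OF pos \<rho> sol, folded g_def]
  have "m \<ge> 0"
    using sol by (simp add: mfg_solution_def)
  have coco: "\<alpha> * (norm (ms n - m))\<^sup>2 \<le> inner (gs n - g) (ms n - m)" for n
    using assms(12) unfolding residual_eq_diff_ellop gs_def[symmetric]
    by (intro cone_inequality_cocoercive[OF mono assms(11) \<open>m \<ge> 0\<close> _ vi(1)])
  \<comment> \<open>\<open>g\<close> is a fixed point of the projected step; the step from \<open>gs n\<close> does not increase the distance to it.\<close>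
  have "(norm (gs (Suc n) - g))\<^sup>2 \<le> (norm (gs n - g))\<^sup>2 - \<delta> * (2 * \<alpha> - \<delta>) * (norm (ms n - m))\<^sup>2" for n
  proof -
    have "norm (gs (Suc n) - g) \<le> norm ((gs n - \<delta> *\<^sub>R (ms n - ?w)) - (g - \<delta> *\<^sub>R (m - ?w)))"
      unfolding gs_def assms(14)
    proof (rule proj_on_nonexpansive_at[OF complete_K_tilde[OF pos] convex_K_tilde[OF pos] vi(2)])
      show "inner (g - \<delta> *\<^sub>R (m - ?w) - g) (z - g) \<le> 0" if "z \<in> ?K" for z
        using vi(3)[OF that] assms(7) by simp
    qed
    also have "(gs n - \<delta> *\<^sub>R (ms n - ?w)) - (g - \<delta> *\<^sub>R (m - ?w)) = (gs n - g) - \<delta> *\<^sub>R (ms n - m)"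
      by (simp add: algebra_simps)
    finally have "(norm (gs (Suc n) - g))\<^sup>2 \<le> (norm ((gs n - g) - \<delta> *\<^sub>R (ms n - m)))\<^sup>2"
      by (intro power_mono) auto
    also have "\<dots> = (norm (gs n - g))\<^sup>2 - 2 * \<delta> * inner (gs n - g) (ms n - m) + \<delta>\<^sup>2 * (norm (ms n - m))\<^sup>2"
      unfolding power2_norm_eq_inner inner_diff_left[of "gs n - g"] inner_diff_right[of _ "gs n - g"]
      by (simp only: inner_scaleR_left inner_scaleR_right inner_commute[of "ms n - m" "gs n - g"])
        (simp add: power2_eq_square)
    also have "\<dots> \<le> (norm (gs n - g))\<^sup>2 - 2 * \<delta> * (\<alpha> * (norm (ms n - m))\<^sup>2) + \<delta>\<^sup>2 * (norm (ms n - m))\<^sup>2"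
      using mult_left_mono[OF coco[of n], of "2 * \<delta>"] assms(7) by simp
    finally show ?thesis
      by (simp add: algebra_simps power2_eq_square)
  qed
  then have "(\<lambda>n. (norm (ms n - m))\<^sup>2) \<longlonglongrightarrow> 0"
    using assms(7,8) by (intro tendsto_0_if_dissipated[of "\<delta> * (2 * \<alpha> - \<delta>)" "\<lambda>n. (norm (gs n - g))\<^sup>2"]) auto
  then have "(\<lambda>n. sqrt ((norm (ms n - m))\<^sup>2)) \<longlonglongrightarrow> sqrt 0"
    by (rule tendsto_real_sqrt)
  then have "(\<lambda>n. norm (ms n - m)) \<longlonglongrightarrow> 0"
    by simp
  then show "ms \<longlonglongrightarrow> m"
    by (rule LIM_zero_cancel[OF tendsto_norm_zero_cancel])
qed

end
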